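(* Let $\check\beta$ and $\check\Omega$ be a regular equivariant pair of estimators with exceptional set $N$, let $N^*$ and $T$ be the associated set and test statistic, and suppose that for every $v\in\mathbb{R}^q$, $v\ne0$, $\lambda_{\mathbb{R}^n}(\{y\in\mathbb{R}^n\setminus N^*:v'\check\Omega^{-1}(y)v=0\})=0$. Let $W(C)=\{y\in\mathbb{R}^n:T(y)\ge C\}$ with $0<C<\infty$. Assume there is a sequence $\Sigma_m\in\mathfrak{C}$ with $\Sigma_m\to\bar\Sigma$ as $m\to\infty$, where $\bar\Sigma$ is singular with $l:=\dim\operatorname{span}(\bar\Sigma)>0$. Suppose that for some sequence of positive reals $s_m$ the matrix $D_m=\Pi_{\operatorname{span}(\bar\Sigma)^\perp}\Sigma_m\Pi_{\operatorname{span}(\bar\Sigma)^\perp}/s_m$ converges to a matrix $D$ which is regular on $\operatorname{span}(\bar\Sigma)^\perp$ (i.e. injective when restricted to $\operatorname{span}(\bar\Sigma)^\perp$), and that $\Pi_{\operatorname{span}(\bar\Sigma)^\perp}\Sigma_m\Pi_{\operatorname{span}(\bar\Sigma)}/s_m^{1/2}\to0$. Suppose further that $\operatorname{span}(\bar\Sigma)\subseteq\mathfrak{M}$, and let $Z$ be a matrix whose columns form a basis of $\operatorname{span}(\bar\Sigma)$. Assume also that $R\hat\beta(z)\ne0$ for $\lambda_{\operatorname{span}(\bar\Sigma)}$-almost every $z$. Then for every $\mu_0\in\mathfrak{M}_0$, every $0<\sigma<\infty$, and every $M\ge0$ $$\inf_{\gamma\in\mathbb{R}^l,\|\gamma\|\ge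 M}\ \inf_{\Sigma\in\mathfrak{C}}P_{\mu_0+Z\gamma,\sigma^2\Sigma}(W(C))\le K_1\le K_2\le\sup_{\Sigma\in\mathfrak{C}}P_{\mu_0,\sigma^2\Sigma}(W(C)).$$ Here $$K_1=\inf_{\gamma\in\mathbb{R}^l}\Pr(\bar\xi(\gamma)\ge0)=\inf_{\|\gamma\|=1}\Pr(\bar\xi(\gamma)\ge0),\qquad K_2=\int\Pr(\bar\xi(\gamma)\ge0)\,dP_{0,A}(\gamma),$$ with the random variable $\bar\xi(\gamma)$ given by $$\bar\xi(\gamma)=(R\hat\beta(Z\gamma))'\,\check\Omega^{-1}\big((\bar\Sigma^{1/2}+D^{1/2})\mathbf{G}\big)\,R\hat\beta(Z\gamma)$$ on the event $\{(\bar\Sigma^{1/2}+D^{1/2})\mathbf{G}\in\mathbb{R}^n\setminus N^*\}$ and $\bar\xi(\gamma)=0$ otherwise, where $\mathbf{G}$ is a standard normal $n$-vector; the matrix $A=(Z'Z)^{-1}Z'\bar\Sigma Z(Z'Z)^{-1}$ is nonsingular, and $P_{0,A}$ is the Gaussian distribution on $\mathbb{R}^l$ with mean zero and covariance matrix $A$.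
   Context: Framework: $n,k,q$ are integers with $1\le k<n$, $q\ge1$; $X$ is a fixed real $n\times k$ matrix of rank $k$; $R$ is a fixed real $q\times k$ matrix of rank $q$; $r\in\mathbb{R}^q$. $\mathfrak{C}$ (covariance model) is a nonempty set of symmetric positive definite $n\times n$ matrices such that $\sigma^2\in(0,\infty)$ and $\Sigma\in\mathfrak{C}$ are uniquely determined by $\sigma^2\Sigma$. $\mathfrak{M}=\operatorname{span}(X)$, $\mathfrak{M}_0=\{X\beta:\beta\in\mathbb{R}^k,\ R\beta=r\}$. $P_{\mu,\Phi}$ is the Gaussian measure with mean $\mu$ and covariance matrix $\Phi$. $\hat\beta(y)=(X'X)^{-1}X'y$. $\Pi_{\mathcal{L}}$ is the orthogonal projection onto the linear subspace $\mathcal{L}$; $\operatorname{span}$ of a matrix is its column space; $\lambda_{\mathcal{L}}$ is Lebesgue measure on $\mathcal{L}$; $A^{1/2}$ is the symmetric nonnegative definite square root. Regular equivariant pair with exceptional set $N$: (i) $\check\beta:\mathbb{R}^n\setminus N\to\mathbb{R}^k$ and $\check\Omega:\mathbb{R}^n\setminus N\to\mathbb{R}^{q\times q}$ are well-defined and continuous on the complement of a closed $\lambda_{\mathbb{R}^n}$-null set $N$, and $\check\Omega$ is symmetric there; (ii) $y\in\mathbb{R}^n\setminus N$ implies $\alpha y+X\gamma\in\mathbb{R}^n\setminus N$ for all $\alpha\ne0$, $\gamma\in\mathbb{R}^k$; (iii) $\check\beta(\alpha y+X\gamma)=\alpha\check\beta(y)+\gamma$ and $\check\Omega(\alpha y+X\gamma)=\alpha^2\check\Omega(y)$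 for all $y\in\mathbb{R}^n\setminus N$, $\alpha\ne0$, $\gamma\in\mathbb{R}^k$; (iv) $\check\Omega$ is nonsingular $\lambda_{\mathbb{R}^n}$-almost everywhere on $\mathbb{R}^n\setminus N$. $N^*=N\cup\{y\in\mathbb{R}^n\setminus N:\det\check\Omega(y)=0\}$. $T(y)=(R\check\beta(y)-r)'\check\Omega^{-1}(y)(R\check\beta(y)-r)$ for $y\in\mathbb{R}^n\setminus N^*$, and $T(y)=0$ for $y\in N^*$. *)

theory Defs
  imports "HOL-Probability.Probability"
begin

definition colspace :: "real^'m^'n \<Rightarrow> (real^'n) set" where
  "colspace A = span (columns A)"

definition columns_basis_of :: "real^'l^'n \<Rightarrow> (real^'n) set \<Rightarrow> bool" where
  "columns_basis_of Z L \<longleftrightarrow>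
     inj (\<lambda>j. column j Z) \<and> independent (columns Z) \<and> span (columns Z) = L"

definition symmetric_mat :: "real^'n^'n \<Rightarrow> bool" where
  "symmetric_mat A \<longleftrightarrow> transpose A = A"

definition pos_def_mat :: "real^'n^'n \<Rightarrow> bool" where
  "pos_def_mat A \<longleftrightarrow> (\<forall>x. x \<noteq> 0 \<longrightarrow> x \<bullet> (A *v x) > 0)"

definition nonneg_def_mat :: "real^'n^'n \<Rightarrow> bool" where
  "nonneg_def_mat A \<longleftrightarrow> (\<forall>x. x \<bullet> (A *v x) \<ge> 0)"

text \<open>Only meaningful for symmetric nonnegative definite arguments.\<close>

definition sqrt_mat :: "real^'n^'n \<Rightarrow> real^'n^'n" where
  "sqrt_mat A = (THE B. symmetric_mat B \<and> nonneg_def_mat B \<and> B ** B = A)"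

definition proj_mat :: "(real^'n) set \<Rightarrow> real^'n^'n" where
  "proj_mat L = (THE P. \<forall>x. P *v x \<in> L \<and> x - P *v x \<in> orthogonal_comp L)"

definition std_gaussian :: "(real^'n) measure" where
  "std_gaussian = density lborel (\<lambda>x. ennreal (\<Prod>i\<in>UNIV. std_normal_density (x $ i)))"

text \<open>The covariance matrix may be singular, hence no density is used here.\<close>

definition gaussian :: "real^'n \<Rightarrow> real^'n^'n \<Rightarrow> (real^'n) measure" where
  "gaussian \<mu> \<Phi> = distr std_gaussian borel (\<lambda>x. \<mu> + sqrt_mat \<Phi> *v x)"

text \<open>Same construction as \<open>lborel\<close>, with an orthonormal basis of the subspace in place of
  \<open>Basis\<close>; by rotation invariance the measure does not depend on the basis. It is a Borel measure
  on the ambient space, concentrated on the subspace.\<close>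

definition lborel_subspace :: "(real^'n) set \<Rightarrow> (real^'n) measure" where
  "lborel_subspace L =
     (let B = (SOME B. pairwise orthogonal B \<and> (\<forall>b\<in>B. norm b = 1) \<and> span B = L)
      in distr (\<Pi>\<^sub>M b\<in>B. lborel) borel (\<lambda>f. \<Sum>b\<in>B. f b *\<^sub>R b))"

definition covariance_model :: "(real^'n^'n) set \<Rightarrow> bool" where
  "covariance_model CC \<longleftrightarrow>
     CC \<noteq> {} \<and>
     (\<forall>\<Sigma>\<in>CC. symmetric_mat \<Sigma> \<and> pos_def_mat \<Sigma>) \<and>
     (\<forall>\<Sigma>\<in>CC. \<forall>\<Sigma>'\<in>CC. \<forall>\<sigma>>0. \<forall>\<sigma>'>0.
        \<sigma>\<^sup>2 *\<^sub>R \<Sigma> = \<sigma>'\<^sup>2 *\<^sub>R \<Sigma>' \<longrightarrow> \<sigma>\<^sup>2 = \<sigma>'\<^sup>2 \<and> \<Sigma> = \<Sigma>')"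

definition M0_set :: "real^'k^'n \<Rightarrow> real^'k^'q \<Rightarrow> real^'q \<Rightarrow> (real^'n) set" where
  "M0_set X R r = {X *v \<beta> |\<beta>. R *v \<beta> = r}"

definition ols :: "real^'k^'n \<Rightarrow> real^'n \<Rightarrow> real^'k" where
  "ols X y = matrix_inv (transpose X ** X) *v (transpose X *v y)"

text \<open>The estimators are total functions, but nothing is required of their values on \<open>N\<close>.\<close>

definition regular_equivariant_pair ::
  "real^'k^'n \<Rightarrow> (real^'n) set \<Rightarrow> (real^'n \<Rightarrow> real^'k) \<Rightarrow> (real^'n \<Rightarrow> real^'q^'q) \<Rightarrow> bool" where
  "regular_equivariant_pair X N \<beta> \<Omega> \<longleftrightarrow>
     closed N \<and> N \<in> null_sets lborel \<and>
     continuous_on (- N) \<beta> \<and> continuous_on (- N) \<Omega> \<and>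
     (\<forall>y. y \<notin> N \<longrightarrow> symmetric_mat (\<Omega> y)) \<and>
     (\<forall>y \<alpha> \<gamma>. y \<notin> N \<and> \<alpha> \<noteq> 0 \<longrightarrow>
        \<alpha> *\<^sub>R y + X *v \<gamma> \<notin> N \<and>
        \<beta> (\<alpha> *\<^sub>R y + X *v \<gamma>) = \<alpha> *\<^sub>R \<beta> y + \<gamma> \<and>
        \<Omega> (\<alpha> *\<^sub>R y + X *v \<gamma>) = \<alpha>\<^sup>2 *\<^sub>R \<Omega> y) \<and>
     (AE y in lborel. y \<notin> N \<longrightarrow> invertible (\<Omega> y))"

definition Nstar :: "(real^'n) set \<Rightarrow> (real^'n \<Rightarrow> real^'q^'q) \<Rightarrow> (real^'n) set" where
  "Nstar N \<Omega> = N \<union> {y. y \<notin> N \<and> det (\<Omega> y) = 0}"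

definition test_stat ::
  "real^'k^'q \<Rightarrow> real^'q \<Rightarrow> (real^'n) set \<Rightarrow> (real^'n \<Rightarrow> real^'k) \<Rightarrow> (real^'n \<Rightarrow> real^'q^'q)
     \<Rightarrow> real^'n \<Rightarrow> real" where
  "test_stat R r N \<beta> \<Omega> y =
     (if y \<in> Nstar N \<Omega> then 0
      else (R *v \<beta> y - r) \<bullet> (matrix_inv (\<Omega> y) *v (R *v \<beta> y - r)))"

definition rejection_region ::
  "real^'k^'q \<Rightarrow> real^'q \<Rightarrow> (real^'n) set \<Rightarrow> (real^'n \<Rightarrow> real^'k) \<Rightarrow> (real^'n \<Rightarrow> real^'q^'q)
     \<Rightarrow> real \<Rightarrow> (real^'n) set" where
  "rejection_region R r N \<beta> \<Omega> C = {y. test_stat R r N \<beta> \<Omega> y \<ge> C}"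

text \<open>The value of the random variable at \<open>\<gamma>\<close> when the standard normal vector takes the value
  \<open>g\<close>.\<close>

definition xi_bar ::
  "real^'k^'n \<Rightarrow> real^'k^'q \<Rightarrow> (real^'n) set \<Rightarrow> (real^'n \<Rightarrow> real^'q^'q) \<Rightarrow> real^'l^'n
     \<Rightarrow> real^'n^'n \<Rightarrow> real^'n^'n \<Rightarrow> real^'n \<Rightarrow> real^'l \<Rightarrow> real" where
  "xi_bar X R N \<Omega> Z \<Sigma> D g \<gamma> =
     (let y = (sqrt_mat \<Sigma> + sqrt_mat D) *v g; v = R *v ols X (Z *v \<gamma>)
      in if y \<notin> Nstar N \<Omega> then v \<bullet> (matrix_inv (\<Omega> y) *v v) else 0)"

end

theory Submission
  imports Defs
begin

text \<open>Let \<open>L\<close> be the span of \<open>Sbar\<close>, let \<open>P\<close> be the orthogonal projection onto \<open>L\<close> and \<open>Q = 1 - P\<close>. The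
hypotheses on the blocks of \<open>Sig m\<close> say that blowing up the directions orthogonal to \<open>L\<close>
makes the degenerate limit regular: with \<open>blow_up m = P + Q / sqrt (s m)\<close> the matrices
\<open>blow_up m ** Sig m ** blow_up m\<close> converge to \<open>\<Gamma> = Sbar + D\<close>, which is positive definite. The two summands of
\<open>\<Gamma>\<close> live on \<open>L\<close> and on its orthogonal complement, so
\<open>sqrt_mat \<Gamma> = sqrt_mat Sbar + sqrt_mat D\<close>, the matrix in the definition of the limit variable.

An observation with mean \<open>\<mu>0 + c z\<close>, where \<open>z \<in> L\<close>, and covariance \<open>\<sigma>\<^sup>2 Sig m\<close> can therefore be written
as \<open>\<mu>0 + c z + \<sigma> (P + sqrt (s m) Q) x\<close>, where \<open>x\<close> is the root of the blown-up covariance applied to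
a standard normal vector \<open>g\<close>. For fixed \<open>g\<close> these \<open>x\<close> converge to \<open>sqrt_mat \<Gamma> g\<close>. As \<open>L\<close> lies in the
span of \<open>X\<close>, the observation is \<open>\<sigma> sqrt (s m) x\<close> plus an element of that span. Equivariance turns
the event that the statistic is at least \<open>C\<close> into
\<open>u' \<Omega>(x)\<^sup>-\<^sup>1 u \<ge> C \<sigma>\<^sup>2 s m\<close> with
\<open>u = \<sigma> sqrt (s m) R \<beta>(x) + c R ols(z) + \<sigma> (1 - sqrt (s m)) R ols(P x)\<close>.
Since \<open>s m\<close> tends to \<open>0\<close>, the threshold disappears in the limit and only the sign of a quadratic form
remains (lemma \<open>tendsto_prob_test_stat\<close>). The nondegeneracy hypothesis makes this form nonzero almost
surely, so that the probabilities converge by dominated convergence.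

Two choices of \<open>c\<close> give the two outer inequalities. If \<open>c\<close> tends to infinity with \<open>m\<close>, the term with
\<open>ols(z)\<close> dominates, and for \<open>z = Z \<gamma>\<close> the limit is the probability that the limit variable at \<open>\<gamma>\<close> is
nonnegative (lemma \<open>exists_tendsto_limit_prob\<close>); where \<open>R ols(Z \<gamma>) = 0\<close>, this probability is \<open>1\<close> and there is
nothing to show. If \<open>c = 0\<close>, the limit of \<open>u\<close> is
\<open>\<sigma> R ols(sqrt_mat Sbar g)\<close>. Because \<open>\<Omega>\<close> is invariant under shifts along \<open>L\<close>, the form depends on \<open>g\<close>
through \<open>P g\<close> in the vector and through \<open>Q g\<close> in the matrix. These two are independent, so the limit
is an average over \<open>\<gamma>\<close>, and \<open>Z \<gamma> = sqrt_mat Sbar g\<close> gives \<open>\<gamma>\<close> the covariance \<open>A\<close> (lemma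
\<open>null_reject_tendsto_integral\<close>). The inequality in the middle compares an infimum with an average, and
the restriction to the unit sphere is possible because only signs matter.

All distributional facts rest on lemma \<open>std_gauss_coisometry\<close>: a linear map \<open>f\<close> between Euclidean spaces
with \<open>f f\<^sup>* = 1\<close> carries the standard Gaussian measure to the standard Gaussian measure. It contains
rotation invariance, the law of a general linear image, and the independence of orthogonal components.\<close>

section \<open>Symmetric matrices and their square roots\<close>

lemma symmetric_mat_inner:
  fixes A :: "real^'n^'n"
  assumes "symmetric_mat A"
  shows "(A *v x) \<bullet> y = x \<bullet> (A *v y)"
  using assms by (metis symmetric_mat_def dot_lmul_matrix transpose_matrix_vector)

lemma inner_transpose_vec:
  fixes A :: "real^'m^'n"
  shows "(transpose A *v x) \<bullet> y = x \<bullet> (A *v y)"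
  by (simp add: dot_lmul_matrix)

lemma symmetric_matI:
  fixes A :: "real^'n^'n"
  assumes "\<And>x y. (A *v x) \<bullet> y = x \<bullet> (A *v y)"
  shows "symmetric_mat A"
proof -
  have "transpose A *v x = A *v x" for x
    by (metis assms inner_transpose_vec vector_eq_rdot)
  then show ?thesis by (simp add: symmetric_mat_def matrix_eq)
qed

text \<open>The first order condition at an extremum: a linear term that is dominated by a quadratic one for every
\<open>t\<close> has to vanish.\<close>

lemma quadratic_bound_imp_zero:
  fixes b c :: real
  assumes "\<And>t. 2 * t * b \<le> t\<^sup>2 * c"
  shows "b = 0"
proof (rule ccontr)
  assume b: "b \<noteq> 0"
  \<comment> \<open>The optimal \<open>t\<close> would be \<open>b / c\<close>; the positive upper bound \<open>d\<close> of \<open>c\<close> avoids cases.\<close>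
  define d where "d = \<bar>c\<bar> + 1"
  have d: "d > 0" "c < d" by (auto simp: d_def)
  have "2 * (b / d) * b \<le> (b / d)\<^sup>2 * c" by (rule assms)
  also have "\<dots> \<le> (b / d)\<^sup>2 * d" using d by (intro mult_left_mono) auto
  also have "\<dots> = (b / d) * b" using d by (simp add: power2_eq_square)
  finally have "(b / d) * b \<le> 0" by simp
  moreover have "(b / d) * b > 0" using b d by (simp add: power2_eq_square[symmetric] zero_less_divide_iff)
  ultimately show False by simp
qed

text \<open>A maximiser of the quadratic form on the unit sphere of the subspace is an eigenvector, since the form
is stationary there in all directions of the subspace and \<open>A\<close> does not lead out of the subspace.\<close>

lemma symmetric_mat_eigenvector_in_subspace:
  fixes A :: "real^'n^'n"
  assumes sym: "symmetric_mat A" and V: "subspace V" "V \<noteq> {0}"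
    and inv: "\<And>x. x \<in> V \<Longrightarrow> A *v x \<in> V"
  obtains v l where "v \<in> V" "norm v = 1" "A *v v = l *\<^sub>R v"
proof -
  define K where "K = V \<inter> sphere 0 1"
  have K: "compact K" unfolding K_def
    using V(1) by (intro closed_Int_compact closed_subspace) auto
  obtain z where z: "z \<in> V" "z \<noteq> 0" using V subspace_0 by fastforce
  have "(1 / norm z) *\<^sub>R z \<in> K"
    using z V(1) by (auto simp: K_def subspace_scale)
  then have "K \<noteq> {}" by blast
  moreover have "continuous_on K (\<lambda>x. x \<bullet> (A *v x))"
    by (intro continuous_intros linear_continuous_on matrix_vector_mul_bounded_linear)
  ultimately obtain v where v: "v \<in> K" and mx: "\<And>x. x \<in> K \<Longrightarrow> x \<bullet> (A *v x) \<le> v \<bullet> (A *v v)"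
    using continuous_attains_sup[OF K] by blast
  define l where "l = v \<bullet> (A *v v)"
  have vV: "v \<in> V" and nv: "norm v = 1" using v by (auto simp: K_def)
  have vv: "v \<bullet> v = 1" using nv by (simp add: dot_square_norm)
  have bound: "x \<bullet> (A *v x) \<le> l * (x \<bullet> x)" if x: "x \<in> V" for x
  proof (cases "x = 0")
    case False
    have "(1 / norm x) *\<^sub>R x \<in> K" using x False V(1) by (auto simp: K_def subspace_scale)
    from mx[OF this] have "(x \<bullet> (A *v x)) / (norm x)\<^sup>2 \<le> l"
      by (simp add: l_def power2_eq_square matrix_vector_mult_scaleR)
    then show ?thesis using False by (simp add: pos_divide_le_eq dot_square_norm)
  qed simp
  have orth: "w \<bullet> (A *v v) = 0" if w: "w \<in> V" "w \<bullet> v = 0" for w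
  proof (rule quadratic_bound_imp_zero)
    fix t
    have "v + t *\<^sub>R w \<in> V" using w vV V(1) by (simp add: subspace_add subspace_scale)
    from bound[OF this]
    have "l + t * (v \<bullet> (A *v w)) + t * (w \<bullet> (A *v v)) + t\<^sup>2 * (w \<bullet> (A *v w))
        \<le> l * (1 + t\<^sup>2 * (w \<bullet> w))"
      using w vv by (simp add: matrix_vector_right_distrib matrix_vector_mult_scaleR inner_add_left
          inner_add_right l_def[symmetric] power2_eq_square inner_commute[of v w] algebra_simps)
    moreover have "v \<bullet> (A *v w) = w \<bullet> (A *v v)"
      using symmetric_mat_inner[OF sym, of v w] by (simp add: inner_commute)
    ultimately show "2 * t * (w \<bullet> (A *v v)) \<le> t\<^sup>2 * (l * (w \<bullet> w) - w \<bullet> (A *v w))"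
      by (simp add: algebra_simps)
  qed
  \<comment> \<open>The residual lies in the subspace and is orthogonal to \<open>v\<close>, hence orthogonal to \<open>A v\<close> and to itself.\<close>
  define u where "u = A *v v - l *\<^sub>R v"
  have uV: "u \<in> V" unfolding u_def using inv vV V(1) by (simp add: subspace_diff subspace_scale)
  have uv: "u \<bullet> v = 0" using vv unfolding u_def l_def inner_diff_left inner_scaleR_left inner_commute[of "A *v v"] by simp
  have "u \<bullet> u = u \<bullet> (A *v v) - l * (u \<bullet> v)" by (simp add: u_def inner_diff_right)
  then have "u \<bullet> u = 0" using orth[OF uV uv] uv by simp
  then have "A *v v = l *\<^sub>R v" by (simp add: u_def)
  with vV nv show ?thesis by (rule that)
qed

text \<open>An orthonormal set of eigenvectors of largest cardinality spans the space: otherwise its orthogonal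
complement is a nontrivial invariant subspace and contributes another eigenvector.\<close>

lemma spectral_theorem_symmetric_mat:
  fixes A :: "real^'n^'n"
  assumes sym: "symmetric_mat A"
  obtains B l where "finite B" "pairwise orthogonal B" "\<And>b. b \<in> B \<Longrightarrow> norm b = 1"
    "span B = UNIV" "\<And>b. b \<in> B \<Longrightarrow> A *v b = l b *\<^sub>R b"
proof -
  define good where "good B \<longleftrightarrow> pairwise orthogonal B \<and> (\<forall>b\<in>B. norm b = 1 \<and> (\<exists>l. A *v b = l *\<^sub>R b))"
    for B :: "(real^'n) set"
  have indep: "independent B" if "good B" for B
    using that by (intro pairwise_orthogonal_independent) (auto simp: good_def)
  have bd: "\<forall>B. good B \<longrightarrow> card B < DIM(real^'n) + 1"
    using independent_bound[OF indep] by (simp add: less_Suc_eq_le)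
  have "good {}" by (simp add: good_def)
  from ex_has_greatest_nat[of good, OF this bd]
  obtain B where B: "good B" and mx: "\<And>B'. good B' \<Longrightarrow> card B' \<le> card B" by blast
  have fin: "finite B" using independent_bound[OF indep[OF B]] by simp
  define V where "V = {x. \<forall>b\<in>B. x \<bullet> b = 0}"
  have subV: "subspace V" by (auto simp: V_def subspace_def inner_add_left)
  have invV: "A *v x \<in> V" if "x \<in> V" for x
  proof -
    have "(A *v x) \<bullet> b = 0" if b: "b \<in> B" for b
    proof -
      obtain l where "A *v b = l *\<^sub>R b" using B b by (auto simp: good_def)
      then show ?thesis using \<open>x \<in> V\<close> b by (simp add: symmetric_mat_inner[OF sym] V_def)
    qed
    then show ?thesis by (simp add: V_def)
  qed
  have V0: "V = {0}"
  proof (rule ccontr)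
    assume "V \<noteq> {0}"
    then obtain v l where v: "v \<in> V" "norm v = 1" "A *v v = l *\<^sub>R v"
      using symmetric_mat_eigenvector_in_subspace[OF sym subV _ invV] by blast
    have "v \<notin> B" using v by (auto simp: V_def)
    have "good (insert v B)"
      using B v by (auto simp: good_def pairwise_insert V_def orthogonal_def inner_commute)
    from mx[OF this] show False using fin \<open>v \<notin> B\<close> by simp
  qed
  have "x \<in> span B" for x
  proof -
    obtain y z where yz: "y \<in> span B" "\<And>w. w \<in> span B \<Longrightarrow> orthogonal z w" "x = y + z"
      using orthogonal_subspace_decomp_exists[of B x] by blast
    have "z \<in> V" using yz(2) by (auto simp: V_def orthogonal_def span_base)
    then show ?thesis using V0 yz by simp
  qed
  then have span: "span B = UNIV" by blast
  have "\<forall>b\<in>B. \<exists>l. A *v b = l *\<^sub>R b" using B by (auto simp: good_def)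
  then obtain l where "\<And>b. b \<in> B \<Longrightarrow> A *v b = l b *\<^sub>R b" by metis
  with B fin span show ?thesis by (intro that[of B l]) (auto simp: good_def)
qed

lemma mat_eq_on_spanning:
  fixes A B :: "real^'n^'m"
  assumes "span S = UNIV" "\<And>b. b \<in> S \<Longrightarrow> A *v b = B *v b"
  shows "A = B"
proof -
  have "A *v x = B *v x" for x
    by (rule linear_eq_on_span[where B=S]) (use assms in \<open>auto simp: matrix_vector_mul_linear\<close>)
  then show ?thesis by (simp add: matrix_eq)
qed

text \<open>If \<open>l > 0\<close>, the vector \<open>u = B v - sqrt l v\<close> satisfies \<open>B u = - sqrt l u\<close>, which a nonnegative definite
\<open>B\<close> permits only for \<open>u = 0\<close>. This is what makes square roots unique: a root is determined on the
eigenvectors of its square.\<close>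

lemma nonneg_square_root_eigenvector:
  fixes B :: "real^'n^'n"
  assumes B: "symmetric_mat B" "nonneg_def_mat B" and v: "(B ** B) *v v = l *\<^sub>R v" "l \<ge> 0"
  shows "B *v v = sqrt l *\<^sub>R v"
proof (cases "l = 0")
  case True
  have "(B *v v) \<bullet> (B *v v) = v \<bullet> ((B ** B) *v v)"
    by (simp add: symmetric_mat_inner[OF B(1)] matrix_vector_mul_assoc)
  then show ?thesis using v True by simp
next
  case False
  define u where "u = B *v v - sqrt l *\<^sub>R v"
  have "B *v u = - sqrt l *\<^sub>R u"
    using v by (simp add: u_def matrix_vector_mult_diff_distrib matrix_vector_mult_scaleR
        matrix_vector_mul_assoc scaleR_diff_right)
  then have "u \<bullet> (B *v u) = - sqrt l * (u \<bullet> u)" by simp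
  moreover have "u \<bullet> (B *v u) \<ge> 0" using B(2) by (simp add: nonneg_def_mat_def)
  moreover have "sqrt l > 0" using v(2) False by simp
  ultimately have "u \<bullet> u \<le> 0"
    by (smt (verit) mult_less_0_iff)
  then have "u = 0" by (metis inner_ge_zero inner_eq_zero_iff order_antisym)
  then show ?thesis by (simp add: u_def)
qed

lemma nonneg_square_root_unique:
  fixes B B' :: "real^'n^'n"
  assumes B: "symmetric_mat B" "nonneg_def_mat B" and B': "symmetric_mat B'" "nonneg_def_mat B'"
    and eq: "B ** B = B' ** B'"
  shows "B = B'"
proof -
  obtain S l where S: "span S = UNIV" "\<And>b. b \<in> S \<Longrightarrow> norm b = 1"
    and l: "\<And>b. b \<in> S \<Longrightarrow> B *v b = l b *\<^sub>R b"
    using spectral_theorem_symmetric_mat[OF B(1)] by metis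
  have "B *v b = B' *v b" if b: "b \<in> S" for b
  proof -
    have "(B ** B) *v b = (l b)\<^sup>2 *\<^sub>R b"
      using l[OF b] by (simp add: matrix_vector_mul_assoc[symmetric] matrix_vector_mult_scaleR power2_eq_square)
    then show ?thesis
      using nonneg_square_root_eigenvector[OF B, of b "(l b)\<^sup>2"]
        nonneg_square_root_eigenvector[OF B', of b "(l b)\<^sup>2"] eq by simp
  qed
  then show ?thesis using S(1) by (rule mat_eq_on_spanning[rotated])
qed

lemma nonneg_square_root_exists:
  fixes A :: "real^'n^'n"
  assumes A: "symmetric_mat A" "nonneg_def_mat A"
  obtains B where "symmetric_mat B" "nonneg_def_mat B" "B ** B = A"
proof -
  obtain S l where S: "finite S" "pairwise orthogonal S" "\<And>b. b \<in> S \<Longrightarrow> norm b = 1" "span S = UNIV"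
    and l: "\<And>b. b \<in> S \<Longrightarrow> A *v b = l b *\<^sub>R b"
    using spectral_theorem_symmetric_mat[OF A(1)] by metis
  have lpos: "l b \<ge> 0" if "b \<in> S" for b
  proof -
    have "b \<bullet> (A *v b) = l b" using l[OF that] S(3)[OF that] by (simp add: dot_square_norm)
    then show ?thesis using A(2) by (metis nonneg_def_mat_def)
  qed
  define f where "f x = (\<Sum>b\<in>S. (sqrt (l b) * (x \<bullet> b)) *\<^sub>R b)" for x
  have lin: "linear f"
    by (rule linearI) (simp_all add: f_def inner_add_left distrib_left scaleR_add_left sum.distrib
        scaleR_sum_right algebra_simps)
  define B where "B = matrix f"
  have B: "B *v x = f x" for x using lin by (simp add: B_def matrix_works)
  have fxy: "f x \<bullet> y = (\<Sum>b\<in>S. sqrt (l b) * (x \<bullet> b) * (y \<bullet> b))" for x y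
    unfolding f_def inner_sum_left by (simp add: inner_commute)
  have "(transpose B *v x) \<bullet> y = (B *v x) \<bullet> y" for x y
    unfolding inner_transpose_vec B by (simp add: fxy inner_commute[of x] mult.commute mult.left_commute)
  then have "symmetric_mat B" unfolding symmetric_mat_def matrix_eq
    by (metis vector_eq_rdot)
  moreover have "nonneg_def_mat B" unfolding nonneg_def_mat_def
  proof
    fix x
    have "x \<bullet> (B *v x) = (\<Sum>b\<in>S. sqrt (l b) * ((x \<bullet> b) * (x \<bullet> b)))"
      unfolding B inner_commute[of x "f x"] fxy by (simp add: mult.assoc)
    also have "\<dots> \<ge> 0" by (intro sum_nonneg mult_nonneg_nonneg[OF _ zero_le_square] real_sqrt_ge_zero lpos)
    finally show "x \<bullet> (B *v x) \<ge> 0" .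
  qed
  moreover have "B ** B = A"
  proof (rule mat_eq_on_spanning[OF S(4)])
    fix b assume b: "b \<in> S"
    have "f b = (\<Sum>c\<in>S. if c = b then sqrt (l b) *\<^sub>R b else 0)" unfolding f_def
    proof (rule sum.cong)
      fix c assume c: "c \<in> S"
      show "(sqrt (l c) * (b \<bullet> c)) *\<^sub>R c = (if c = b then sqrt (l b) *\<^sub>R b else 0)"
        using S(2,3) b c by (auto simp: pairwise_def orthogonal_def dot_square_norm)
    qed simp
    then have fb: "f b = sqrt (l b) *\<^sub>R b" using S(1) b by simp
    show "(B ** B) *v b = A *v b"
      using lpos[OF b] by (simp add: matrix_vector_mul_assoc[symmetric] B fb linear_scale[OF lin] l[OF b])
  qed
  ultimately show ?thesis by (rule that)
qed

lemma sqrt_mat_unique: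
  assumes "symmetric_mat B" "nonneg_def_mat B" "B ** B = A"
  shows "sqrt_mat A = B"
  unfolding sqrt_mat_def
  using assms by (intro the_equality) (auto intro: nonneg_square_root_unique)

lemma sqrt_mat:
  assumes "symmetric_mat A" "nonneg_def_mat A"
  shows "symmetric_mat (sqrt_mat A)" "nonneg_def_mat (sqrt_mat A)" "sqrt_mat A ** sqrt_mat A = A"
  using nonneg_square_root_exists[OF assms] sqrt_mat_unique by metis+

lemma nonneg_if_pos_def_mat: "pos_def_mat A \<Longrightarrow> nonneg_def_mat A"
  by (metis inner_zero_left less_eq_real_def nonneg_def_mat_def pos_def_mat_def)

lemma invertible_if_kernel_trivial:
  fixes A :: "real^'n^'n"
  assumes "\<And>x. A *v x = 0 \<Longrightarrow> x = 0"
  shows "invertible A"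
  using assms by (auto simp: invertible_left_inverse matrix_left_invertible_ker)

lemma pos_def_mat_invertible: "pos_def_mat A \<Longrightarrow> invertible A"
  by (rule invertible_if_kernel_trivial) (force simp: pos_def_mat_def)

lemma sqrt_mat_kernel:
  assumes "symmetric_mat A" "nonneg_def_mat A" "x \<bullet> (A *v x) = 0"
  shows "sqrt_mat A *v x = 0"
proof -
  note S = sqrt_mat[OF assms(1,2)]
  have "(sqrt_mat A *v x) \<bullet> (sqrt_mat A *v x) = x \<bullet> (A *v x)"
    by (simp add: symmetric_mat_inner[OF S(1)] matrix_vector_mul_assoc S(3))
  then show ?thesis using assms(3) by simp
qed

lemma mat_kernel_if_quadratic_zero:
  assumes "symmetric_mat A" "nonneg_def_mat A" "x \<bullet> (A *v x) = 0"
  shows "A *v x = 0"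
  using sqrt_mat_kernel[OF assms] sqrt_mat(3)[OF assms(1,2)]
  by (metis matrix_vector_mul_assoc matrix_vector_mult_0_right)

lemma pos_def_mat_sqrt:
  assumes "symmetric_mat A" "pos_def_mat A"
  shows "invertible (sqrt_mat A)" "pos_def_mat (sqrt_mat A)"
proof -
  note S = sqrt_mat[OF assms(1) nonneg_if_pos_def_mat[OF assms(2)]]
  have ker: "x = 0" if "sqrt_mat A *v x = 0" for x
  proof -
    have "A *v x = 0" using that S(3) by (metis matrix_vector_mul_assoc matrix_vector_mult_0_right)
    then show ?thesis using assms(2) by (force simp: pos_def_mat_def)
  qed
  then show "invertible (sqrt_mat A)" by (rule invertible_if_kernel_trivial)
  show "pos_def_mat (sqrt_mat A)"
    unfolding pos_def_mat_def
    by (metis S(1,2) ker mat_kernel_if_quadratic_zero nonneg_def_mat_def order_le_imp_less_or_eq)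
qed

lemma pos_def_mat_lower_bound:
  fixes A :: "real^'n^'n"
  assumes "pos_def_mat A"
  obtains c where "c > 0" "\<And>x. x \<bullet> (A *v x) \<ge> c * (norm x)\<^sup>2"
proof -
  have "compact (sphere (0::real^'n) 1)" "sphere (0::real^'n) 1 \<noteq> {}" by auto
  moreover have "continuous_on (sphere (0::real^'n) 1) (\<lambda>x. x \<bullet> (A *v x))"
    by (intro continuous_intros linear_continuous_on matrix_vector_mul_bounded_linear)
  ultimately obtain v where v: "norm v = 1" and mn: "\<And>x. norm x = 1 \<Longrightarrow> v \<bullet> (A *v v) \<le> x \<bullet> (A *v x)"
    using continuous_attains_inf[of "sphere (0::real^'n) 1"] by (metis mem_sphere_0)
  have "v \<bullet> (A *v v) > 0" using assms v by (metis norm_zero pos_def_mat_def zero_neq_one)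
  moreover have "v \<bullet> (A *v v) * (norm x)\<^sup>2 \<le> x \<bullet> (A *v x)" for x
  proof (cases "x = 0")
    case False
    have "v \<bullet> (A *v v) \<le> (x \<bullet> (A *v x)) / (norm x)\<^sup>2"
      using mn[of "(1 / norm x) *\<^sub>R x"] False
      by (simp add: power2_eq_square matrix_vector_mult_scaleR)
    then show ?thesis using False by (simp add: pos_le_divide_eq)
  qed simp
  ultimately show ?thesis by (rule that)
qed

lemma inner_transpose_transpose:
  fixes A B :: "real^'m^'n"
  shows "transpose A \<bullet> transpose B = A \<bullet> B"
  unfolding inner_vec_def transpose_def by (simp add: sum.swap[of _ "UNIV::'m set"])

text \<open>The inner product of matrices is taken entrywise, so here \<open>S\<close> acts on the rows of \<open>E\<close>.\<close>

lemma inner_matrix_mult_symmetric: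
  fixes E :: "real^'n^'m" and S :: "real^'n^'n"
  assumes "symmetric_mat S"
  shows "E \<bullet> (E ** S) = (\<Sum>i\<in>UNIV. (E $ i) \<bullet> (S *v (E $ i)))"
proof -
  have "(E ** S) $ i = S *v (E $ i)" for i
    using assms unfolding symmetric_mat_def
    by (simp add: vec_eq_iff matrix_matrix_mult_def matrix_vector_mult_def transpose_def mult.commute)
  then show ?thesis by (simp add: inner_vec_def[of E])
qed

text \<open>With \<open>S\<close> and \<open>T\<close> the two roots and \<open>E = S - T\<close>, one has \<open>A - B = S E + E T\<close>. In the Frobenius inner
product with \<open>E\<close> the first summand contributes a nonnegative number and the second at least \<open>c |E|\<^sup>2\<close>; the
Cauchy-Schwarz inequality does the rest.\<close>

lemma sqrt_mat_lipschitz: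
  fixes A B :: "real^'n^'n"
  assumes A: "symmetric_mat A" "nonneg_def_mat A" and B: "symmetric_mat B" "nonneg_def_mat B"
    and c: "c > 0" "\<And>x. x \<bullet> (sqrt_mat B *v x) \<ge> c * (norm x)\<^sup>2"
  shows "norm (sqrt_mat A - sqrt_mat B) \<le> norm (A - B) / c"
proof -
  define S T where "S = sqrt_mat A" and "T = sqrt_mat B"
  have S: "symmetric_mat S" "nonneg_def_mat S" "S ** S = A"
    and T: "symmetric_mat T" "nonneg_def_mat T" "T ** T = B"
    using sqrt_mat[OF A] sqrt_mat[OF B] by (auto simp: S_def T_def)
  define E where "E = S - T"
  have Esym: "transpose E = E" using S(1) T(1) unfolding E_def symmetric_mat_def transpose_def
    by (simp add: vec_eq_iff)
  have "A - B = S ** E + E ** T"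
    by (simp add: E_def S(3)[symmetric] T(3)[symmetric] matrix_matrix_mult_def vec_eq_iff
        sum.distrib[symmetric] sum_subtractf[symmetric] algebra_simps)
  also have "E \<bullet> (S ** E + E ** T) = E \<bullet> (E ** S) + E \<bullet> (E ** T)"
  proof -
    have "E \<bullet> (S ** E) = transpose E \<bullet> transpose (S ** E)" by (simp add: inner_transpose_transpose)
    also have "\<dots> = E \<bullet> (E ** S)" using S(1) Esym by (simp add: matrix_transpose_mul symmetric_mat_def)
    finally show ?thesis by (simp add: inner_add_right)
  qed
  finally have eq: "E \<bullet> (A - B) = E \<bullet> (E ** S) + E \<bullet> (E ** T)" .
  have "E \<bullet> (E ** S) \<ge> 0" using S by (auto simp: inner_matrix_mult_symmetric nonneg_def_mat_def intro!: sum_nonneg)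
  moreover have "E \<bullet> (E ** T) \<ge> c * (norm E)\<^sup>2"
  proof -
    have "(norm E)\<^sup>2 = (\<Sum>i\<in>UNIV. (norm (E $ i))\<^sup>2)"
      by (simp add: power2_norm_eq_inner inner_vec_def[of E])
    then show ?thesis using c(2) by (simp add: inner_matrix_mult_symmetric[OF T(1)] sum_distrib_left) (simp add: T_def sum_mono)
  qed
  moreover have "E \<bullet> (A - B) \<le> norm E * norm (A - B)" by (rule norm_cauchy_schwarz)
  ultimately have "norm E * (c * norm E) \<le> norm E * norm (A - B)"
    using eq by (simp add: power2_eq_square algebra_simps)
  then have "c * norm E \<le> norm (A - B)"
    by (cases "E = 0") auto
  then show ?thesis using c(1) by (simp add: E_def S_def T_def pos_le_divide_eq mult.commute)
qed

lemma tendsto_sqrt_mat: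
  fixes A :: "nat \<Rightarrow> real^'n^'n"
  assumes lim: "A \<longlonglongrightarrow> B" and A: "\<And>m. symmetric_mat (A m)" "\<And>m. nonneg_def_mat (A m)"
    and B: "symmetric_mat B" "pos_def_mat B"
  shows "(\<lambda>m. sqrt_mat (A m)) \<longlonglongrightarrow> sqrt_mat B"
proof -
  obtain c where c: "c > 0" "\<And>x. x \<bullet> (sqrt_mat B *v x) \<ge> c * (norm x)\<^sup>2"
    using pos_def_mat_lower_bound[OF pos_def_mat_sqrt(2)[OF B]] by metis
  have "(\<lambda>m. norm (A m - B) / c) \<longlonglongrightarrow> 0"
    using lim by (auto intro!: tendsto_eq_intros simp: LIM_zero_iff tendsto_norm_zero_iff c(1) less_imp_neq[OF c(1), symmetric])
  moreover have "norm (sqrt_mat (A m) - sqrt_mat B) \<le> norm (A m - B) / c" for m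
    by (rule sqrt_mat_lipschitz[OF A B(1) nonneg_if_pos_def_mat[OF B(2)] c])
  ultimately have "(\<lambda>m. sqrt_mat (A m) - sqrt_mat B) \<longlonglongrightarrow> 0"
    using Lim_null_comparison[of "\<lambda>m. sqrt_mat (A m) - sqrt_mat B" "\<lambda>m. norm (A m - B) / c" sequentially]
    by simp
  then show ?thesis by (simp add: LIM_zero_iff)
qed

lemma tendsto_matrix_mult:
  fixes A :: "nat \<Rightarrow> real^'m^'n" and B :: "nat \<Rightarrow> real^'k^'m"
  assumes "A \<longlonglongrightarrow> A'" "B \<longlonglongrightarrow> B'"
  shows "(\<lambda>i. A i ** B i) \<longlonglongrightarrow> A' ** B'"
  unfolding matrix_matrix_mult_def
  by (intro tendsto_vec_lambda tendsto_sum tendsto_mult tendsto_vec_nth assms)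

lemma tendsto_matrix_transpose:
  fixes A :: "nat \<Rightarrow> real^'m^'n"
  assumes "A \<longlonglongrightarrow> A'"
  shows "(\<lambda>i. transpose (A i)) \<longlonglongrightarrow> transpose A'"
  unfolding transpose_def by (intro tendsto_vec_lambda tendsto_vec_nth assms)

lemma symmetric_nonneg_limit:
  fixes A :: "nat \<Rightarrow> real^'n^'n"
  assumes lim: "A \<longlonglongrightarrow> A'" and A: "\<And>m. symmetric_mat (A m)" "\<And>m. nonneg_def_mat (A m)"
  shows "symmetric_mat A'" "nonneg_def_mat A'"
proof -
  show "symmetric_mat A'"
    using LIMSEQ_unique[OF tendsto_matrix_transpose[OF lim]] lim A(1) by (simp add: symmetric_mat_def)
  have "x \<bullet> (A' *v x) \<ge> 0" for x
  proof (rule LIMSEQ_le_const)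
    show "(\<lambda>m. x \<bullet> (A m *v x)) \<longlonglongrightarrow> x \<bullet> (A' *v x)"
      unfolding matrix_vector_mult_def
      by (intro tendsto_inner tendsto_const tendsto_vec_lambda tendsto_sum tendsto_mult tendsto_vec_nth lim)
  qed (use A(2) in \<open>auto simp: nonneg_def_mat_def\<close>)
  then show "nonneg_def_mat A'" by (simp add: nonneg_def_mat_def)
qed

lemma congruence_symmetric_nonneg:
  fixes A B :: "real^'n^'n"
  assumes A: "symmetric_mat A" "nonneg_def_mat A" and B: "symmetric_mat B"
  shows "symmetric_mat (B ** A ** B)" "nonneg_def_mat (B ** A ** B)"
proof -
  show "symmetric_mat (B ** A ** B)"
    by (rule symmetric_matI)
       (simp add: matrix_vector_mul_assoc[symmetric] symmetric_mat_inner[OF A(1)] symmetric_mat_inner[OF B])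
  show "nonneg_def_mat (B ** A ** B)"
    using A(2) by (simp add: nonneg_def_mat_def matrix_vector_mul_assoc[symmetric]
        symmetric_mat_inner[OF B, symmetric])
qed

lemma matrix_inv_mult:
  fixes A :: "real^'n^'n"
  assumes "invertible A"
  shows "matrix_inv A ** A = mat 1" "A ** matrix_inv A = mat 1"
proof -
  have "\<exists>B. A ** B = mat 1 \<and> B ** A = mat 1" using assms by (simp add: invertible_def)
  then have "A ** matrix_inv A = mat 1 \<and> matrix_inv A ** A = mat 1"
    unfolding matrix_inv_def by (rule someI_ex)
  then show "matrix_inv A ** A = mat 1" "A ** matrix_inv A = mat 1" by auto
qed

lemma symmetric_matrix_inv:
  fixes A :: "real^'n^'n"
  assumes "symmetric_mat A" "invertible A"
  shows "symmetric_mat (matrix_inv A)"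
proof -
  note I = matrix_inv_mult[OF assms(2)]
  have "transpose (matrix_inv A) ** A = mat 1"
    using arg_cong[OF I(2), of transpose] assms(1) by (simp add: matrix_transpose_mul symmetric_mat_def)
  then have "transpose (matrix_inv A) ** (A ** matrix_inv A) = matrix_inv A"
    by (simp add: matrix_mul_assoc)
  then show ?thesis by (simp add: I(2) symmetric_mat_def)
qed

lemma symmetric_mat_mult_transpose: "symmetric_mat (F ** transpose F)"
  by (simp add: symmetric_mat_def matrix_transpose_mul)

section \<open>Rotation invariance of the standard Gaussian measure\<close>

lemma borel_measurable_linear:
  fixes f :: "'a::euclidean_space \<Rightarrow> 'b::euclidean_space"
  assumes "linear f"
  shows "f \<in> borel_measurable borel"
  using assms by (intro borel_measurable_continuous_onI linear_continuous_on) (simp add: linear_linear)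

text \<open>The inverse isometry carries the image measure back to Lebesgue measure, and sigma-finiteness passes
from an image measure to its source.\<close>

lemma sigma_finite_measure_distr_linear_isometry:
  fixes f :: "'a::euclidean_space \<Rightarrow> 'a"
  assumes f: "linear f" "\<And>x. norm (f x) = norm x"
  shows "sigma_finite_measure (distr lborel borel f)"
proof -
  have inj: "inj f" by (metis f linear_injective_0 norm_eq_zero)
  have [measurable]: "f \<in> borel_measurable borel"
    by (rule borel_measurable_linear[OF f(1)])
  obtain g where g: "linear g" "\<And>x. g (f x) = x"
    using linear_injective_left_inverse[OF f(1) inj] by (metis comp_apply id_apply)
  have [measurable]: "g \<in> borel_measurable borel"
    by (rule borel_measurable_linear[OF g(1)])
  have "distr (distr lborel borel f) borel g = distr lborel borel (\<lambda>x. x)"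
    by (simp add: distr_distr comp_def g(2))
  then have "sigma_finite_measure (distr (distr lborel borel f) borel g)"
    by (simp add: distr_id2 sigma_finite_lborel)
  then show ?thesis by (rule sigma_finite_measure_distr) simp
qed

text \<open>The image \<open>\<mu>\<close> of Lebesgue measure is again invariant under translations. For such \<open>\<mu>\<close>, computing
\<open>\<integral>\<integral> 1\<^sub>A(x) 1\<^sub>B(x + y) dy d\<mu>(x)\<close> in both orders shows \<open>\<mu>(A) \<lambda>(B) = \<lambda>(A) \<mu>(B)\<close>. The unit ball \<open>B\<close> is mapped
to itself by an isometry and has positive finite measure, so it can be cancelled.\<close>

lemma lborel_linear_isometry:
  fixes f :: "'a::euclidean_space \<Rightarrow> 'a"
  assumes f: "linear f" "\<And>x. norm (f x) = norm x"
  shows "distr lborel borel f = lborel"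
proof -
  define \<mu> where "\<mu> = distr lborel borel f"
  have inj: "inj f" by (metis f linear_injective_0 norm_eq_zero)
  then have surj: "surj f" using f(1) by (simp add: linear_injective_imp_surjective)
  have [measurable]: "f \<in> borel_measurable borel"
    by (rule borel_measurable_linear[OF f(1)])
  have sets[measurable_cong]: "sets \<mu> = sets borel" and space: "space \<mu> = UNIV" by (simp_all add: \<mu>_def)
  have shift: "distr \<mu> borel ((+) c) = \<mu>" for c
  proof -
    obtain c' where c': "f c' = c" using surj by (metis surjD)
    have "distr \<mu> borel ((+) c) = distr (distr lborel borel ((+) c')) borel f"
      unfolding \<mu>_def by (simp add: distr_distr comp_def linear_add[OF f(1)] c')
    then show ?thesis by (simp add: lborel_distr_plus \<mu>_def)
  qed
  \<comment> \<open>Lebesgue measure is also invariant under reflections, which the exchange of integrals needs.\<close>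
  have reflect: "distr lborel borel (\<lambda>y. x - y) = lborel" for x :: 'a
    using lborel_affine[of "-1" x] by (simp add: density_1 one_ennreal_def[symmetric])
  interpret M: sigma_finite_measure \<mu>
    unfolding \<mu>_def by (rule sigma_finite_measure_distr_linear_isometry[OF f])
  interpret L: sigma_finite_measure "lborel :: 'a measure" by (rule sigma_finite_lborel)
  interpret P: pair_sigma_finite \<mu> "lborel :: 'a measure" ..
  define B where "B = ball (0::'a) 1"
  have [measurable]: "B \<in> sets borel" by (simp add: B_def)
  have "f -` B = B" by (auto simp: B_def f(2))
  then have mB: "emeasure \<mu> B = emeasure lborel B" by (simp add: \<mu>_def emeasure_distr)
  have Bfin: "emeasure lborel B \<noteq> \<infinity>"
    using emeasure_lborel_ball_finite[of "0::'a" 1] by (simp add: B_def)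
  have Bpos: "emeasure lborel B \<noteq> 0"
    using emeasure_lborel_ball_finite[of "0::'a" 1] content_ball_pos[of 1 "0::'a"]
    by (auto simp: B_def measure_def)
  show ?thesis unfolding \<mu>_def[symmetric]
  proof (rule measure_eqI)
    fix A assume "A \<in> sets \<mu>"
    then have [measurable]: "A \<in> sets borel" by (simp add: sets)
    have "emeasure \<mu> A * emeasure lborel B = (\<integral>\<^sup>+x. indicator A x * emeasure lborel B \<partial>\<mu>)"
      by (simp add: nn_integral_multc sets)
    also have "\<dots> = (\<integral>\<^sup>+x. \<integral>\<^sup>+y. indicator A x * indicator B (x + y) \<partial>lborel \<partial>\<mu>)"
    proof (rule nn_integral_cong)
      fix x
      have "emeasure lborel B = (\<integral>\<^sup>+y. indicator B y \<partial>distr lborel borel ((+) x))"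
        by (simp add: lborel_distr_plus)
      also have "\<dots> = (\<integral>\<^sup>+y. indicator B (x + y) \<partial>lborel)" by (subst nn_integral_distr) simp_all
      finally show "indicator A x * emeasure lborel B
          = (\<integral>\<^sup>+y. indicator A x * indicator B (x + y) \<partial>lborel)"
        by (simp add: nn_integral_cmult)
    qed
    also have "\<dots> = (\<integral>\<^sup>+y. \<integral>\<^sup>+x. indicator A x * indicator B (x + y) \<partial>\<mu> \<partial>lborel)"
      by (rule P.Fubini'[symmetric]) simp
    also have "\<dots> = (\<integral>\<^sup>+y. \<integral>\<^sup>+x. indicator A (x - y) * indicator B x \<partial>\<mu> \<partial>lborel)"
    proof (rule nn_integral_cong)
      fix y
      have "(\<integral>\<^sup>+x. indicator A x * indicator B (x + y) \<partial>\<mu>)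
          = (\<integral>\<^sup>+x. indicator A x * indicator B (x + y) \<partial>distr \<mu> borel ((+) (- y)))"
        by (simp only: shift)
      also have "\<dots> = (\<integral>\<^sup>+x. indicator A (x - y) * indicator B x \<partial>\<mu>)"
        by (subst nn_integral_distr) simp_all
      finally show "(\<integral>\<^sup>+x. indicator A x * indicator B (x + y) \<partial>\<mu>)
          = (\<integral>\<^sup>+x. indicator A (x - y) * indicator B x \<partial>\<mu>)" .
    qed
    also have "\<dots> = (\<integral>\<^sup>+x. \<integral>\<^sup>+y. indicator A (x - y) * indicator B x \<partial>lborel \<partial>\<mu>)"
      by (rule P.Fubini') simp
    also have "\<dots> = (\<integral>\<^sup>+x. emeasure lborel A * indicator B x \<partial>\<mu>)"
    proof (rule nn_integral_cong)
      fix x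
      have "(\<integral>\<^sup>+y. indicator A (x - y) \<partial>lborel) = (\<integral>\<^sup>+y. indicator A y \<partial>distr lborel borel (\<lambda>y. x - y))"
        by (subst nn_integral_distr) simp_all
      also have "\<dots> = emeasure lborel A" by (simp add: reflect)
      finally show "(\<integral>\<^sup>+y. indicator A (x - y) * indicator B x \<partial>lborel) = emeasure lborel A * indicator B x"
        by (simp add: nn_integral_multc)
    qed
    also have "\<dots> = emeasure lborel A * emeasure lborel B"
      by (simp add: nn_integral_cmult sets mB)
    finally show "emeasure \<mu> A = emeasure lborel A"
      using Bfin Bpos by (metis ennreal_mult_cancel_left infinity_ennreal_def mult.commute)
  qed (simp add: sets)
qed

text \<open>The standard Gaussian measure on an arbitrary Euclidean space, so that products of Euclidean spaces are
covered. The density is written as a function of the norm, which makes rotation invariance visible.\<close>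

definition std_gauss :: "'a::euclidean_space measure" where
  "std_gauss = density lborel (\<lambda>x. ennreal ((1 / sqrt (2 * pi)) ^ DIM('a) * exp (- (norm x)\<^sup>2 / 2)))"

lemma sets_std_gauss [simp, measurable_cong]: "sets std_gauss = sets borel"
  by (simp add: std_gauss_def)

lemma space_std_gauss [simp]: "space std_gauss = UNIV"
  by (simp add: std_gauss_def)

lemma std_gaussian_eq_std_gauss: "std_gaussian = (std_gauss :: (real^'n) measure)"
proof -
  have "(\<Prod>i\<in>UNIV. std_normal_density (x $ i))
      = (1 / sqrt (2 * pi)) ^ DIM(real^'n) * exp (- (norm x)\<^sup>2 / 2)" for x :: "real^'n"
  proof -
    have "(norm x)\<^sup>2 = (\<Sum>i\<in>UNIV. (x $ i)\<^sup>2)"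
      unfolding power2_norm_eq_inner inner_vec_def by (simp add: power2_eq_square)
    then show ?thesis
      by (simp add: std_normal_density_def prod.distrib exp_sum[symmetric] sum_negf
          sum_divide_distrib[symmetric] prod_dividef power_one_over)
  qed
  then show ?thesis by (simp add: std_gaussian_def std_gauss_def)
qed

lemma prob_space_std_gauss: "prob_space (std_gauss :: 'a::euclidean_space measure)"
proof
  have "ennreal ((1 / sqrt (2 * pi)) ^ DIM('a) * exp (- (norm x)\<^sup>2 / 2))
      = (\<Prod>b\<in>Basis. ennreal (std_normal_density (x \<bullet> b)))" for x :: 'a
  proof -
    have "(norm x)\<^sup>2 = (\<Sum>b\<in>Basis. (x \<bullet> b)\<^sup>2)"
      unfolding power2_norm_eq_inner euclidean_inner[of x x] by (simp add: power2_eq_square)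
    then have "(1 / sqrt (2 * pi)) ^ DIM('a) * exp (- (norm x)\<^sup>2 / 2) = (\<Prod>b\<in>Basis. std_normal_density (x \<bullet> b))"
      by (simp add: std_normal_density_def prod.distrib exp_sum[symmetric] sum_negf
          sum_divide_distrib[symmetric] prod_dividef power_one_over)
    then show ?thesis by (simp add: prod_ennreal)
  qed
  then have "emeasure (std_gauss :: 'a measure) UNIV
      = (\<integral>\<^sup>+x. (\<Prod>b\<in>Basis. ennreal (std_normal_density (x \<bullet> b))) \<partial>(lborel :: 'a measure))"
    by (simp add: std_gauss_def emeasure_density)
  also have "\<dots> = (\<Prod>b\<in>(Basis::'a set). \<integral>\<^sup>+x. ennreal (std_normal_density x) \<partial>lborel)"
    by (rule nn_integral_lborel_prod) auto
  also have "(\<integral>\<^sup>+x. ennreal (std_normal_density x) \<partial>lborel) = 1"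
    by (subst nn_integral_eq_integral) auto
  finally show "emeasure (std_gauss :: 'a measure) (space std_gauss) = 1" by simp
qed

lemma std_gauss_pair:
  "(std_gauss :: 'a::euclidean_space measure) \<Otimes>\<^sub>M (std_gauss :: 'b::euclidean_space measure) = std_gauss"
proof -
  interpret prob_space "std_gauss :: 'b measure" by (rule prob_space_std_gauss)
  have "(std_gauss :: 'a measure) \<Otimes>\<^sub>M (std_gauss :: 'b measure)
      = density (lborel \<Otimes>\<^sub>M lborel) (\<lambda>(x, y).
          ennreal ((1 / sqrt (2 * pi)) ^ DIM('a) * exp (- (norm x)\<^sup>2 / 2)) *
          ennreal ((1 / sqrt (2 * pi)) ^ DIM('b) * exp (- (norm y)\<^sup>2 / 2)))"
    unfolding std_gauss_def
    using sigma_finite_measure_axioms unfolding std_gauss_def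
    by (intro pair_measure_density) (auto simp: sigma_finite_lborel)
  also have "\<dots> = std_gauss"
    unfolding std_gauss_def lborel_prod
  proof (intro arg_cong[where f="density lborel"] ext)
    fix z :: "'a \<times> 'b"
    obtain x y where z: "z = (x, y)" by force
    have "exp (- (norm z)\<^sup>2 / 2) = exp (- (norm x)\<^sup>2 / 2) * exp (- (norm y)\<^sup>2 / 2)"
      by (simp add: z norm_prod_def exp_add[symmetric] add_divide_distrib[symmetric])
    then show "(case z of (x, y) \<Rightarrow> ennreal ((1 / sqrt (2 * pi)) ^ DIM('a) * exp (- (norm x)\<^sup>2 / 2)) *
          ennreal ((1 / sqrt (2 * pi)) ^ DIM('b) * exp (- (norm y)\<^sup>2 / 2)))
        = ennreal ((1 / sqrt (2 * pi)) ^ DIM('a \<times> 'b) * exp (- (norm z)\<^sup>2 / 2))"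
      by (simp add: z ennreal_mult[symmetric] power_add mult.assoc mult.left_commute)
  qed
  finally show ?thesis .
qed

lemma std_gauss_linear_isometry:
  fixes f :: "'a::euclidean_space \<Rightarrow> 'a"
  assumes f: "linear f" "\<And>x. norm (f x) = norm x"
  shows "distr std_gauss borel f = std_gauss"
proof -
  have [measurable]: "f \<in> borel_measurable borel"
    by (rule borel_measurable_linear[OF f(1)])
  let ?d = "\<lambda>x::'a. ennreal ((1 / sqrt (2 * pi)) ^ DIM('a) * exp (- (norm x)\<^sup>2 / 2))"
  have "distr std_gauss borel f = distr (density lborel (\<lambda>x. ?d (f x))) borel f"
    by (simp add: std_gauss_def f(2))
  also have "\<dots> = density (distr lborel borel f) ?d" by (rule density_distr[symmetric]) simp_all
  also have "\<dots> = std_gauss" by (simp add: lborel_linear_isometry[OF f] std_gauss_def)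
  finally show ?thesis .
qed

text \<open>The hypotheses say that \<open>g\<close> is the adjoint of \<open>f\<close> and that \<open>f f\<^sup>* = 1\<close>. Source and target may have
different dimensions, and \<open>f\<close> is, up to rotation, a coordinate projection. To avoid a complement
of the range of \<open>g\<close>, the rotation is performed on the product of source and target:
\<open>(x, y) \<mapsto> (g y + (x - g (f x)), f x)\<close> is an isometry whose second component is \<open>f\<close>.\<close>

lemma std_gauss_coisometry:
  fixes f :: "'a::euclidean_space \<Rightarrow> 'b::euclidean_space" and g :: "'b \<Rightarrow> 'a"
  assumes f: "linear f" and g: "linear g" and adj: "\<And>x y. f x \<bullet> y = x \<bullet> g y" and fg: "\<And>y. f (g y) = y"
  shows "distr std_gauss borel f = std_gauss"
proof -
  define T where "T = (\<lambda>(x, y). (g y + (x - g (f x)), f x))"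
  have linT: "linear T"
    by (rule linearI) (auto simp: T_def linear_add[OF f] linear_add[OF g] linear_scale[OF f]
        linear_scale[OF g] algebra_simps)
  have normT: "norm (T z) = norm z" for z
  proof -
    obtain x y where z: "z = (x, y)" by force
    have 1: "g a \<bullet> g b = a \<bullet> b" for a b using adj[of "g a" b] fg by simp
    have 2: "g a \<bullet> x = a \<bullet> f x" for a using adj[of x a] by (simp add: inner_commute)
    have "T z \<bullet> T z = z \<bullet> z"
      by (simp add: z T_def inner_add_left inner_add_right inner_diff_left inner_diff_right 1 2
          inner_commute[of x "g _"] inner_commute[of y "f x"])
    then show ?thesis by (simp add: norm_eq_sqrt_inner)
  qed
  have [measurable]: "f \<in> borel_measurable borel" "T \<in> borel_measurable borel"
    using f linT by (auto intro: borel_measurable_linear)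
  have [measurable]: "T \<in> measurable (borel \<Otimes>\<^sub>M borel) (borel \<Otimes>\<^sub>M borel)"
    unfolding borel_prod by simp
  interpret A: prob_space "std_gauss :: 'a measure" by (rule prob_space_std_gauss)
  interpret B: prob_space "std_gauss :: 'b measure" by (rule prob_space_std_gauss)
  interpret P: pair_prob_space "std_gauss :: 'a measure" "std_gauss :: 'b measure" ..
  let ?P = "(std_gauss :: 'a measure) \<Otimes>\<^sub>M (std_gauss :: 'b measure)"
  have "distr std_gauss borel f = distr (distr ?P std_gauss fst) borel f"
    by (simp add: B.distr_pair_fst)
  also have "\<dots> = distr ?P borel (\<lambda>z. snd (T z))"
    by (subst distr_distr) (auto simp: comp_def T_def case_prod_beta)
  also have "\<dots> = distr (distr ?P (borel \<Otimes>\<^sub>M borel) T) borel snd"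
    by (subst distr_distr) (auto simp: comp_def)
  also have "distr ?P (borel \<Otimes>\<^sub>M borel) T = ?P"
    unfolding std_gauss_pair borel_prod by (rule std_gauss_linear_isometry[OF linT normT])
  also have "distr ?P borel snd = distr ?P std_gauss snd" by (rule distr_cong) auto
  also have "\<dots> = std_gauss"
  proof (rule measure_eqI)
    fix X assume "X \<in> sets (distr ?P (std_gauss :: 'b measure) snd)"
    then have [measurable]: "X \<in> sets borel" by simp
    have "emeasure (distr ?P std_gauss snd) X = emeasure ?P (UNIV \<times> X)"
      by (subst emeasure_distr) (auto simp: space_pair_measure intro!: arg_cong2[where f=emeasure])
    also have "\<dots> = emeasure std_gauss X"
      using A.emeasure_space_1 by (subst B.emeasure_pair_measure_Times) auto
    finally show "emeasure (distr ?P std_gauss snd) X = emeasure std_gauss X" .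
  qed simp
  finally show ?thesis .
qed

section \<open>Gaussian measures as linear images of the standard Gaussian\<close>

lemma matrix_vector_mult_measurable [measurable]:
  fixes A :: "real^'m^'n"
  shows "(\<lambda>x. A *v x) \<in> borel_measurable borel"
  by (rule borel_measurable_linear) simp

lemma prob_space_gaussian: "prob_space (gaussian \<mu> \<Phi>)"
  unfolding gaussian_def std_gaussian_eq_std_gauss
  by (intro prob_space.prob_space_distr prob_space_std_gauss) simp

text \<open>With \<open>S\<close> the root of \<open>\<Phi>\<close>, the matrix \<open>M = S\<^sup>-\<^sup>1 F\<close> satisfies \<open>M M' = 1\<close>, so \<open>M x\<close> is again standard Gaussian
and \<open>F x = S (M x)\<close> has the law of \<open>S x\<close>. Any factor \<open>F\<close> of the covariance may thus replace its root, also a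
rectangular one.\<close>

lemma gaussian_eq_distr_std_gauss:
  fixes F :: "real^'a^'b" and \<Phi> :: "real^'b^'b"
  assumes \<Phi>: "F ** transpose F = \<Phi>" "pos_def_mat \<Phi>"
  shows "gaussian \<mu> \<Phi> = distr std_gauss borel (\<lambda>x. \<mu> + F *v x)"
proof -
  define S where "S = sqrt_mat \<Phi>"
  have sym: "symmetric_mat \<Phi>" using \<Phi>(1) symmetric_mat_mult_transpose by metis
  note S = sqrt_mat[OF sym nonneg_if_pos_def_mat[OF \<Phi>(2)], folded S_def]
  note inv = pos_def_mat_sqrt(1)[OF sym \<Phi>(2), folded S_def]
  define M where "M = matrix_inv S ** F"
  have SM: "S ** M = F" by (simp add: M_def matrix_mul_assoc matrix_inv_mult(2)[OF inv])
  have "M ** transpose M = matrix_inv S ** (F ** transpose F) ** matrix_inv S"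
    using symmetric_matrix_inv[OF S(1) inv]
    by (simp add: M_def matrix_transpose_mul symmetric_mat_def matrix_mul_assoc)
  also have "\<dots> = (matrix_inv S ** S) ** (S ** matrix_inv S)"
    by (simp add: \<Phi>(1) S(3)[symmetric] matrix_mul_assoc)
  finally have MM: "M ** transpose M = mat 1" by (simp add: matrix_inv_mult[OF inv])
  have "distr std_gauss borel ((*v) M) = std_gauss"
  proof (rule std_gauss_coisometry[where g="(*v) (transpose M)"])
    show "(M *v x) \<bullet> y = x \<bullet> (transpose M *v y)" for x y
      using inner_transpose_vec[of M y x] by (simp add: inner_commute)
    show "M *v (transpose M *v y) = y" for y by (simp add: matrix_vector_mul_assoc MM del: transpose_matrix_vector)
  qed (auto simp: matrix_vector_mul_linear)
  then have "gaussian \<mu> \<Phi> = distr (distr std_gauss borel ((*v) M)) borel (\<lambda>x. \<mu> + S *v x)"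
    by (simp add: gaussian_def std_gaussian_eq_std_gauss S_def)
  also have "\<dots> = distr std_gauss borel (\<lambda>x. \<mu> + F *v x)"
    by (subst distr_distr) (auto simp: comp_def matrix_vector_mul_assoc SM)
  finally show ?thesis .
qed

lemma AE_std_gauss_if_null_lborel:
  assumes "A \<in> null_sets lborel"
  shows "AE x in std_gauss. x \<notin> A"
proof -
  have "AE x in lborel. x \<notin> A" using assms by (rule AE_not_in)
  then show ?thesis unfolding std_gauss_def by (subst AE_density) (auto elim: eventually_mono)
qed

lemma AE_std_gauss_invertible_image:
  fixes F :: "real^'n^'n"
  assumes F: "invertible F" and A: "A \<in> null_sets lborel"
  shows "AE x in std_gauss. F *v x \<notin> A"
proof -
  have "negligible A" using A by (simp add: negligible_iff_null_sets null_sets_completionI)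
  then have "negligible ((*v) (matrix_inv F) ` A)"
    by (rule negligible_differentiable_image_negligible[rotated])
       (auto intro!: linear_imp_differentiable_on matrix_vector_mul_linear)
  moreover have "(*v) F -` A \<in> sets borel"
    using A measurable_sets_borel[OF matrix_vector_mult_measurable, of A F] by auto
  moreover have "(*v) F -` A \<subseteq> (*v) (matrix_inv F) ` A"
  proof
    fix x assume "x \<in> (*v) F -` A"
    then show "x \<in> (*v) (matrix_inv F) ` A"
      by (auto intro!: image_eqI[of _ _ "F *v x"] simp: matrix_vector_mul_assoc matrix_inv_mult[OF F])
  qed
  ultimately have "(*v) F -` A \<in> null_sets lborel"
    by (metis negligible_iff_null_sets negligible_subset null_sets_completion_iff sets_lborel)
  from AE_std_gauss_if_null_lborel[OF this] show ?thesis by simp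
qed

text \<open>A proper subspace is a null set for Lebesgue measure.\<close>

lemma AE_std_gauss_not_in_kernel:
  fixes f :: "'a::euclidean_space \<Rightarrow> 'b::real_normed_vector"
  assumes f: "linear f" and x: "f x \<noteq> 0"
  shows "AE x in std_gauss. f x \<noteq> 0"
proof -
  define V where "V = {x. f x = 0}"
  have sub: "subspace V" unfolding V_def using f by (simp add: linear_subspace_kernel)
  have "dim V < DIM('a)"
    using x dim_eq_full[of V] dim_subset_UNIV[of V] span_eq_iff[of V] sub
    by (metis UNIV_I V_def le_neq_implies_less mem_Collect_eq)
  then have "negligible V" by (rule negligible_lowdim)
  then have "V \<in> null_sets lborel"
    using closed_subspace[OF sub] by (metis borel_closed negligible_iff_null_sets null_sets_completion_iff sets_lborel)
  from AE_std_gauss_if_null_lborel[OF this] show ?thesis by (simp add: V_def)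
qed

text \<open>Independence of \<open>P g\<close> and \<open>g - P g\<close>, in the form in which it is used: for independent standard Gaussian
\<open>g'\<close> and \<open>g\<close> the vector \<open>P g' + (g - P g)\<close> is again standard Gaussian, because this map is a coisometry on
the product space. Substituting it for \<open>g\<close> replaces \<open>E g\<close> by \<open>E g'\<close>, while \<open>F g\<close> changes only by an
element of the range of \<open>F P\<close>, which \<open>H\<close> does not notice.\<close>

lemma emeasure_std_gauss_decouple:
  fixes P E F :: "real^'n^'n" and H :: "((real^'n) \<times> (real^'n)) set"
  assumes P: "symmetric_mat P" "P ** P = P" and E: "E ** P = E"
    and H [measurable]: "H \<in> sets borel"
    and inv: "\<And>z x u. (z, x + F *v (P *v u)) \<in> H \<longleftrightarrow> (z, x) \<in> H"
  shows "emeasure std_gauss {g. (E *v g, F *v g) \<in> H}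
    = (\<integral>\<^sup>+ g'. emeasure std_gauss {g. (E *v g', F *v g) \<in> H} \<partial>std_gauss)"
proof -
  let ?G = "std_gauss :: (real^'n) measure"
  interpret prob_space ?G by (rule prob_space_std_gauss)
  define f where "f = (\<lambda>(g', g). P *v g' + (g - P *v g))"
  have PP: "P *v (P *v x) = P *v x" for x by (simp add: matrix_vector_mul_assoc P(2))
  have linf: "linear f"
    by (rule linearI) (auto simp: f_def matrix_vector_right_distrib matrix_vector_mult_scaleR algebra_simps)
  have f_meas: "f \<in> borel_measurable borel"
    by (rule borel_measurable_linear[OF linf])
  have law: "distr std_gauss borel f = ?G"
  proof (rule std_gauss_coisometry[OF linf])
    show "linear (\<lambda>h. (P *v h, h - P *v h))"
      by (rule linearI) (auto simp: matrix_vector_right_distrib matrix_vector_mult_scaleR algebra_simps)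
    show "f p \<bullet> h = p \<bullet> (P *v h, h - P *v h)" for p h
      by (cases p) (simp add: f_def inner_add_left inner_diff_left inner_diff_right symmetric_mat_inner[OF P(1)])
    show "f (P *v h, h - P *v h) = h" for h
      by (simp add: f_def PP matrix_vector_mult_diff_distrib)
  qed
  have iff: "(E *v f (g', g), F *v f (g', g)) \<in> H \<longleftrightarrow> (E *v g', F *v g) \<in> H" for g' g
  proof -
    have "E *v f (g', g) = E *v g'"
      by (simp add: f_def matrix_vector_right_distrib matrix_vector_mult_diff_distrib matrix_vector_mul_assoc E)
    moreover have "f (g', g) = g + P *v (g' - g)"
      by (simp add: f_def matrix_vector_mult_diff_distrib)
    then have "F *v f (g', g) = F *v g + F *v (P *v (g' - g))"
      by (simp add: matrix_vector_right_distrib)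
    ultimately show ?thesis by (simp add: inv)
  qed
  have set_meas: "{g. (E *v g, F *v g) \<in> H} \<in> sets borel"
  proof -
    have "(\<lambda>g. (E *v g, F *v g)) \<in> borel_measurable borel" by measurable
    from measurable_sets_borel[OF this H] show ?thesis by (simp add: vimage_def)
  qed
  have "emeasure ?G {g. (E *v g, F *v g) \<in> H}
      = emeasure (distr std_gauss borel f) {g. (E *v g, F *v g) \<in> H}"
    by (simp add: law)
  also have "\<dots> = emeasure std_gauss {(g', g). (E *v g', F *v g) \<in> H}"
    using f_meas set_meas by (subst emeasure_distr) (auto simp: iff intro!: arg_cong2[where f=emeasure])
  also have "\<dots> = emeasure (?G \<Otimes>\<^sub>M ?G) {(g', g). (E *v g', F *v g) \<in> H}"
    by (simp add: std_gauss_pair)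
  also have "\<dots> = (\<integral>\<^sup>+ g'. emeasure ?G (Pair g' -` {(g', g). (E *v g', F *v g) \<in> H}) \<partial>?G)"
  proof (rule emeasure_pair_measure_alt)
    have "(\<lambda>p. (E *v fst p, F *v snd p)) \<in> borel_measurable (borel :: ((real^'n) \<times> (real^'n)) measure)"
      unfolding borel_prod[symmetric] by measurable
    from measurable_sets_borel[OF this H]
    have "{(g', g). (E *v g', F *v g) \<in> H} \<in> sets borel" by (simp add: vimage_def case_prod_unfold)
    then show "{(g', g). (E *v g', F *v g) \<in> H} \<in> sets (?G \<Otimes>\<^sub>M ?G)"
      unfolding std_gauss_pair by simp
  qed
  finally show ?thesis by (simp add: vimage_def)
qed

section \<open>Orthogonal projections and least squares\<close>

lemma proj_mat:
  fixes L :: "(real^'n) set"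
  assumes L: "subspace L"
  shows "proj_mat L *v x \<in> L" "x - proj_mat L *v x \<in> orthogonal_comp L"
proof -
  let ?p = "\<lambda>x u. u \<in> L \<and> x - u \<in> orthogonal_comp L"
  have unique: "u = u'" if "?p x u" "?p x u'" for x u u'
  proof -
    have "u - u' \<in> L" using that L by (simp add: subspace_diff)
    moreover have "u - u' = (x - u') - (x - u)" by simp
    then have "u - u' \<in> orthogonal_comp L"
      using that subspace_diff[OF subspace_orthogonal_comp] by metis
    ultimately have "orthogonal (u - u') (u - u')" by (auto simp: orthogonal_comp_def)
    then show ?thesis by (simp add: orthogonal_self)
  qed
  have "\<exists>u. ?p x u" for x
    using orthogonal_subspace_decomp_exists[of L x] span_eq_iff[of L] L
    unfolding orthogonal_comp_def
    by (smt (verit, best) add_diff_cancel_left' mem_Collect_eq orthogonal_commute)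
  then obtain f where f: "\<And>x. ?p x (f x)" by metis
  have "linear f"
  proof (rule linearI)
    fix x y c
    have "(x + y) - (f x + f y) = (x - f x) + (y - f y)" "c *\<^sub>R x - c *\<^sub>R f x = c *\<^sub>R (x - f x)"
      by (simp_all add: algebra_simps)
    then show "f (x + y) = f x + f y" "f (c *\<^sub>R x) = c *\<^sub>R f x"
      using f[of x] f[of y] L subspace_orthogonal_comp[of L]
      by (metis (no_types, lifting) f unique subspace_add subspace_scale)+
  qed
  then have "matrix f *v x = f x" for x by (simp add: matrix_works)
  with f have ex: "\<forall>x. ?p x (matrix f *v x)" by simp
  have "\<forall>x. ?p x (proj_mat L *v x)"
    unfolding proj_mat_def by (rule theI[where a="matrix f"]) (use ex unique in \<open>auto simp: matrix_eq\<close>, metis)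
  then show "proj_mat L *v x \<in> L" "x - proj_mat L *v x \<in> orthogonal_comp L" by auto
qed

text \<open>The two conditions determine the projection, as a vector in both \<open>L\<close> and its complement is
orthogonal to itself.\<close>

lemma proj_mat_eqI:
  assumes L: "subspace L" and u: "u \<in> L" "x - u \<in> orthogonal_comp L"
  shows "proj_mat L *v x = u"
proof -
  let ?u = "proj_mat L *v x"
  have "u - ?u \<in> L" using u proj_mat[OF L] L by (simp add: subspace_diff)
  moreover have "u - ?u = (x - ?u) - (x - u)" by simp
  then have "u - ?u \<in> orthogonal_comp L"
    using u proj_mat[OF L] subspace_diff[OF subspace_orthogonal_comp] by metis
  ultimately have "orthogonal (u - ?u) (u - ?u)" by (auto simp: orthogonal_comp_def)
  then show ?thesis by (simp add: orthogonal_self)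
qed

lemma proj_mat_in: "subspace L \<Longrightarrow> x \<in> L \<Longrightarrow> proj_mat L *v x = x"
  by (rule proj_mat_eqI) (auto simp: subspace_0 subspace_orthogonal_comp)

lemma proj_mat_orthogonal_comp:
  assumes "subspace L"
  shows "proj_mat (orthogonal_comp L) = mat 1 - proj_mat L"
  unfolding matrix_eq
proof
  fix x
  show "proj_mat (orthogonal_comp L) *v x = (mat 1 - proj_mat L) *v x"
    using proj_mat[OF assms, of x] orthogonal_comp_subset[of L]
    by (intro proj_mat_eqI) (auto simp: subspace_orthogonal_comp matrix_vector_mult_diff_rdistrib)
qed

lemma proj_mat_idem: "subspace L \<Longrightarrow> proj_mat L ** proj_mat L = proj_mat L"
  unfolding matrix_eq by (simp add: matrix_vector_mul_assoc[symmetric] proj_mat_in proj_mat)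

lemma symmetric_proj_mat:
  assumes L: "subspace L"
  shows "symmetric_mat (proj_mat L)"
proof (rule symmetric_matI)
  fix x y
  let ?P = "proj_mat L"
  have "orthogonal (?P *v x) (y - ?P *v y)" "orthogonal (?P *v y) (x - ?P *v x)"
    using proj_mat[OF L] by (auto simp: orthogonal_comp_def)
  then show "(?P *v x) \<bullet> y = x \<bullet> (?P *v y)"
    by (simp add: orthogonal_def inner_diff_right inner_commute)
qed

lemma colspace_eq_range: "colspace A = range ((*v) A)"
proof
  show "colspace A \<subseteq> range ((*v) A)" unfolding colspace_def
  proof (rule span_minimal)
    show "columns A \<subseteq> range ((*v) A)"
      unfolding columns_def by (auto simp: matrix_vector_mult_basis[symmetric])
    show "subspace (range ((*v) A))"
      by (intro linear_subspace_image matrix_vector_mul_linear subspace_UNIV)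
  qed
  show "range ((*v) A) \<subseteq> colspace A"
    unfolding colspace_def by (auto intro: matrix_vector_mult_in_columnspace)
qed

lemma gram_invertible:
  fixes X :: "real^'k^'n"
  assumes "inj ((*v) X)"
  shows "invertible (transpose X ** X)"
proof (rule invertible_if_kernel_trivial)
  fix x assume "(transpose X ** X) *v x = 0"
  then have "(transpose X *v (X *v x)) \<bullet> x = 0" by (simp add: matrix_vector_mul_assoc)
  then have "X *v x = X *v 0" by (simp add: inner_transpose_vec del: transpose_matrix_vector)
  then show "x = 0" using assms by (metis injD)
qed

lemma ols_mult:
  assumes "inj ((*v) X)"
  shows "ols X (X *v b) = b"
  using matrix_inv_mult(1)[OF gram_invertible[OF assms]]
  by (simp add: ols_def matrix_vector_mul_assoc matrix_mul_assoc)

lemma mult_ols_in_colspace: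
  assumes "inj ((*v) X)" "y \<in> colspace X"
  shows "X *v ols X y = y"
  using assms by (auto simp: colspace_eq_range ols_mult)

lemma ols_eq_matrix: "ols X = (*v) (matrix_inv (transpose X ** X) ** transpose X)"
  by (simp add: fun_eq_iff ols_def matrix_vector_mul_assoc del: transpose_matrix_vector)

lemma columns_basis_of_inj:
  fixes Z :: "real^'l^'n"
  assumes "columns_basis_of Z L"
  shows "inj ((*v) Z)" "colspace Z = L"
proof -
  have Z: "inj (\<lambda>j. column j Z)" "independent (columns Z)" "span (columns Z) = L"
    using assms by (auto simp: columns_basis_of_def)
  have "columns Z = range (\<lambda>j. column j Z)" by (auto simp: columns_def)
  then have "card (columns Z) = CARD('l)" using Z(1) by (simp add: card_image)
  then have "rank Z = CARD('l)" using Z(2) by (simp add: column_rank_def dim_eq_card_independent)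
  then show "inj ((*v) Z)" by (simp add: full_rank_injective)
  show "colspace Z = L" using Z(3) by (simp add: colspace_def)
qed

text \<open>The measure is carried by \<open>L\<close> and is not zero, as it gives the image of the unit cube in orthonormal
coordinates the measure \<open>1\<close>.\<close>

lemma AE_lborel_subspace_imp_ex:
  fixes L :: "(real^'n) set"
  assumes L: "subspace L" and ae: "AE z in lborel_subspace L. Q z"
  shows "\<exists>z\<in>L. Q z"
proof (rule ccontr)
  assume neg: "\<not> (\<exists>z\<in>L. Q z)"
  define B where "B = (SOME B. pairwise orthogonal B \<and> (\<forall>b\<in>B. norm b = 1) \<and> span B = L)"
  have "\<exists>B. pairwise orthogonal B \<and> (\<forall>b\<in>B. norm b = 1) \<and> span B = L"
    using orthonormal_basis_subspace[OF L] by metis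
  from someI_ex[OF this] have B: "pairwise orthogonal B" "\<forall>b\<in>B. norm b = 1" "span B = L"
    by (auto simp: B_def[symmetric])
  have "independent B" using B by (intro pairwise_orthogonal_independent) auto
  then have fin: "finite B" by (rule finiteI_independent)
  interpret product_sigma_finite "\<lambda>_::real^'n. lborel :: real measure"
    by (simp add: product_sigma_finite_def sigma_finite_lborel)
  let ?M = "\<Pi>\<^sub>M b\<in>B. lborel :: real measure"
  have meas: "(\<lambda>f. \<Sum>b\<in>B. f b *\<^sub>R b) \<in> measurable ?M borel"
    by (intro borel_measurable_sum borel_measurable_scaleR) (auto intro: measurable_component_singleton)
  have "AE f in ?M. Q (\<Sum>b\<in>B. f b *\<^sub>R b)"
    using ae unfolding lborel_subspace_def Let_def B_def[symmetric] by (rule AE_distrD[OF meas])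
  moreover have "(\<Sum>b\<in>B. f b *\<^sub>R b) \<in> L" for f
    unfolding B(3)[symmetric] by (intro span_sum span_scale span_base)
  ultimately have "AE f in ?M. False" using neg by (auto elim!: eventually_mono)
  then have "emeasure ?M (space ?M) = 0" by (simp add: AE_iff_measurable[of "space ?M"])
  moreover have "emeasure ?M (\<Pi>\<^sub>E b\<in>B. {0..1}) = 1"
    using fin by (subst emeasure_PiM) auto
  moreover have "emeasure ?M (\<Pi>\<^sub>E b\<in>B. {0..1}) \<le> emeasure ?M (space ?M)"
    by (rule emeasure_space)
  ultimately show False by simp
qed

section \<open>The quadratic form of an equivariant pair\<close>

lemma continuous_on_det:
  fixes A :: "'a::topological_space \<Rightarrow> real^'n^'n"
  assumes "\<And>i j. continuous_on S (\<lambda>x. A x $ i $ j)"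
  shows "continuous_on S (\<lambda>x. det (A x))"
  unfolding det_def by (intro continuous_intros assms)

text \<open>By Cramer's rule the coordinates of \<open>A\<^sup>-\<^sup>1 w\<close> are quotients of determinants.\<close>

lemma continuous_on_matrix_inv_mult:
  fixes A :: "'a::topological_space \<Rightarrow> real^'n^'n" and w :: "'a \<Rightarrow> real^'n"
  assumes A: "continuous_on S A" and w: "continuous_on S w" and det: "\<And>x. x \<in> S \<Longrightarrow> det (A x) \<noteq> 0"
  shows "continuous_on S (\<lambda>x. matrix_inv (A x) *v w x)"
proof -
  let ?c = "\<lambda>x k. det (\<chi> i j. if j = k then w x $ i else A x $ i $ j) / det (A x)"
  have Aij: "continuous_on S (\<lambda>x. A x $ i $ j)" for i j
    by (intro continuous_intros A)
  have "continuous_on S (\<lambda>x. \<chi> k. ?c x k)"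
  proof (intro continuous_on_vec_lambda continuous_on_divide continuous_on_det Aij ballI det)
    show "continuous_on S (\<lambda>x. (\<chi> i j. if j = k then w x $ i else A x $ i $ j) $ i $ j)" for i j k
      using Aij w by (cases "j = k") (auto intro!: continuous_intros)
  qed
  moreover have "matrix_inv (A x) *v w x = (\<chi> k. ?c x k)" if "x \<in> S" for x
  proof -
    have "A x *v (matrix_inv (A x) *v w x) = w x"
      using det[OF that] by (simp add: matrix_vector_mul_assoc matrix_inv_mult invertible_det_nz)
    then show ?thesis using cramer[OF det[OF that]] by blast
  qed
  ultimately show ?thesis by simp
qed

text \<open>Where the limit is nonzero, its sign is eventually the sign of \<open>f m g - t m\<close>, so the indicator functions
converge almost everywhere.\<close>

lemma measure_tendsto_if_AE_nonzero_limit: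
  assumes M: "prob_space M"
    and meas: "\<And>m. {g \<in> space M. f m g \<ge> t m} \<in> sets M" "{g \<in> space M. f' g \<ge> (0::real)} \<in> sets M"
    and t: "t \<longlonglongrightarrow> 0" and f: "AE g in M. f' g \<noteq> 0 \<and> (\<lambda>m. f m g) \<longlonglongrightarrow> f' g"
  shows "(\<lambda>m. measure M {g \<in> space M. f m g \<ge> t m}) \<longlonglongrightarrow> measure M {g \<in> space M. f' g \<ge> 0}"
proof -
  interpret prob_space M by (rule M)
  have "(\<lambda>m. \<integral>g. indicator {g \<in> space M. f m g \<ge> t m} g \<partial>M)
      \<longlonglongrightarrow> (\<integral>g. indicator {g \<in> space M. f' g \<ge> 0} g \<partial>M :: real)"
  proof (rule integral_dominated_convergence[where w="\<lambda>_. 1"])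
    show "AE g in M. (\<lambda>m. indicator {g \<in> space M. f m g \<ge> t m} g :: real)
        \<longlonglongrightarrow> indicator {g \<in> space M. f' g \<ge> 0} g"
      using f AE_space
    proof eventually_elim
      case (elim g)
      have lim: "(\<lambda>m. f m g - t m) \<longlonglongrightarrow> f' g" using tendsto_diff[of "\<lambda>m. f m g" "f' g" sequentially t 0] elim t by simp
      have "\<forall>\<^sub>F m in sequentially. (f m g \<ge> t m) = (f' g \<ge> 0)"
      proof (cases "f' g > 0")
        case True
        from order_tendstoD(1)[OF lim this] show ?thesis by eventually_elim (use True in auto)
      next
        case False
        then have neg: "f' g < 0" using elim by simp
        from order_tendstoD(2)[OF lim this] show ?thesis by eventually_elim (use neg in auto)
      qed
      then have "\<forall>\<^sub>F m in sequentially. indicator {g \<in> space M. f' g \<ge> 0} g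
          = (indicator {g \<in> space M. f m g \<ge> t m} g :: real)"
        by eventually_elim (auto simp: indicator_def)
      then show ?case by (rule Lim_transform_eventually[OF tendsto_const])
    qed
  qed (use meas in \<open>auto simp: indicator_def\<close>)
  then show ?thesis using meas by simp
qed

locale equivariant_test =
  fixes X :: "real^'k^'n" and R :: "real^'k^'q" and r :: "real^'q"
    and N :: "(real^'n) set" and \<beta> :: "real^'n \<Rightarrow> real^'k" and \<Omega> :: "real^'n \<Rightarrow> real^'q^'q"
  assumes inj_X: "inj ((*v) X)"
    and pair: "regular_equivariant_pair X N \<beta> \<Omega>"
    and nondegenerate: "\<And>v. v \<noteq> 0 \<Longrightarrow>
           {y. y \<notin> Nstar N \<Omega> \<and> v \<bullet> (matrix_inv (\<Omega> y) *v v) = 0} \<in> null_sets lborel"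

begin

text \<open>The value \<open>0\<close> on the exceptional set is shared by the test statistic and by the limit variable, so both are
instances of this form.\<close>

definition quad :: "real^'q \<Rightarrow> real^'n \<Rightarrow> real" where
  "quad w y = (if y \<in> Nstar N \<Omega> then 0 else w \<bullet> (matrix_inv (\<Omega> y) *v w))"

lemma test_stat_eq_quad: "test_stat R r N \<beta> \<Omega> y = quad (R *v \<beta> y - r) y"
  by (simp add: test_stat_def quad_def)

lemma xi_bar_eq_quad: "xi_bar X R N \<Omega> Z \<Sigma> D g \<gamma>
    = quad (R *v ols X (Z *v \<gamma>)) ((sqrt_mat \<Sigma> + sqrt_mat D) *v g)"
  by (simp add: xi_bar_def quad_def Let_def)

lemma
  shows closed_N: "closed N" and null_N: "N \<in> null_sets lborel"
    and cont_\<beta>: "continuous_on (- N) \<beta>" and cont_\<Omega>: "continuous_on (- N) \<Omega>"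
    and AE_invertible: "AE y in lborel. y \<notin> N \<longrightarrow> invertible (\<Omega> y)"
  using pair by (auto simp: regular_equivariant_pair_def)

lemma equivariant:
  assumes "y \<notin> N" "\<alpha> \<noteq> 0"
  shows "\<alpha> *\<^sub>R y + X *v \<gamma> \<notin> N" "\<beta> (\<alpha> *\<^sub>R y + X *v \<gamma>) = \<alpha> *\<^sub>R \<beta> y + \<gamma>"
    "\<Omega> (\<alpha> *\<^sub>R y + X *v \<gamma>) = \<alpha>\<^sup>2 *\<^sub>R \<Omega> y"
  using pair assms unfolding regular_equivariant_pair_def by blast+

lemma notin_NstarD: "y \<notin> Nstar N \<Omega> \<Longrightarrow> y \<notin> N" "y \<notin> Nstar N \<Omega> \<Longrightarrow> det (\<Omega> y) \<noteq> 0"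
  by (auto simp: Nstar_def)

lemma open_Compl_Nstar: "open (- Nstar N \<Omega>)"
proof -
  have "continuous_on (- N) (\<lambda>y. det (\<Omega> y))"
    by (intro continuous_on_det continuous_intros cont_\<Omega>)
  then have "open (- N \<inter> (\<lambda>y. det (\<Omega> y)) -` (- {0}))"
    by (rule continuous_open_preimage) (use closed_N in \<open>auto simp: open_Compl\<close>)
  moreover have "- Nstar N \<Omega> = - N \<inter> (\<lambda>y. det (\<Omega> y)) -` (- {0})"
    by (auto simp: Nstar_def)
  ultimately show ?thesis by simp
qed

lemma borel_Nstar [measurable]: "Nstar N \<Omega> \<in> sets borel"
  using open_Compl_Nstar by (simp add: closed_def borel_closed)

lemma null_Nstar: "Nstar N \<Omega> \<in> null_sets lborel"
proof -
  have "AE y in lborel. y \<notin> N" using null_N by (rule AE_not_in)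
  with AE_invertible have "AE y in lborel. y \<notin> Nstar N \<Omega>"
    by eventually_elim (auto simp: Nstar_def invertible_det_nz)
  then show ?thesis using AE_iff_null_sets[of "Nstar N \<Omega>" lborel] by simp
qed

text \<open>One implication is immediate from equivariance; the other one is the same implication for the inverse
transformation.\<close>

lemma Nstar_equivariant:
  assumes "\<alpha> \<noteq> 0"
  shows "\<alpha> *\<^sub>R y + X *v \<gamma> \<in> Nstar N \<Omega> \<longleftrightarrow> y \<in> Nstar N \<Omega>"
proof -
  have imp: "\<alpha> *\<^sub>R y + X *v \<gamma> \<notin> Nstar N \<Omega>" if "y \<notin> Nstar N \<Omega>" "\<alpha> \<noteq> 0" for y \<alpha> \<gamma>
  proof -
    have "invertible (\<alpha>\<^sup>2 *\<^sub>R \<Omega> y)"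
      using notin_NstarD(2)[OF that(1)] that(2) by (intro scalar_invertible) (auto simp: invertible_det_nz)
    then show ?thesis
      using equivariant[OF notin_NstarD(1)[OF that(1)] that(2), of \<gamma>]
      by (simp add: Nstar_def invertible_det_nz)
  qed
  have "(1 / \<alpha>) *\<^sub>R (\<alpha> *\<^sub>R y + X *v \<gamma>) + X *v ((- 1 / \<alpha>) *\<^sub>R \<gamma>) = y"
    unfolding matrix_vector_mult_scaleR using assms by (simp add: scaleR_add_right)
  then show ?thesis using imp[of y \<alpha> \<gamma>] imp[of "\<alpha> *\<^sub>R y + X *v \<gamma>" "1 / \<alpha>" "(- 1 / \<alpha>) *\<^sub>R \<gamma>"] assms by auto
qed

lemma quad_scale_left: "quad (c *\<^sub>R w) y = c\<^sup>2 * quad w y"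
  by (simp add: quad_def matrix_vector_mult_scaleR power2_eq_square)

lemma quad_equivariant:
  assumes "\<alpha> \<noteq> 0"
  shows "quad w (\<alpha> *\<^sub>R y + X *v \<gamma>) = quad w y / \<alpha>\<^sup>2"
proof (cases "y \<in> Nstar N \<Omega>")
  case False
  note y = notin_NstarD[OF False]
  have inv: "invertible (\<Omega> y)" using y(2) by (simp add: invertible_det_nz)
  define u where "u = matrix_inv (\<Omega> y) *v w"
  have u: "\<Omega> y *v u = w" by (simp add: u_def matrix_vector_mul_assoc matrix_inv_mult[OF inv])
  have "invertible (\<alpha>\<^sup>2 *\<^sub>R \<Omega> y)" using inv assms by (simp add: scalar_invertible)
  then have "matrix_inv (\<alpha>\<^sup>2 *\<^sub>R \<Omega> y) *v ((\<alpha>\<^sup>2 *\<^sub>R \<Omega> y) *v ((1 / \<alpha>\<^sup>2) *\<^sub>R u)) = (1 / \<alpha>\<^sup>2) *\<^sub>R u"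
    by (simp add: matrix_vector_mul_assoc matrix_inv_mult)
  moreover have "(\<alpha>\<^sup>2 *\<^sub>R \<Omega> y) *v ((1 / \<alpha>\<^sup>2) *\<^sub>R u) = w"
    using assms u by (simp add: matrix_vector_mult_scaleR scaleR_matrix_vector_assoc[symmetric])
  ultimately show ?thesis
    using False Nstar_equivariant[OF assms] equivariant(3)[OF y(1) assms]
    by (simp add: quad_def u_def)
qed (simp add: quad_def Nstar_equivariant[OF assms])

lemma quad_add_colspace:
  assumes "z \<in> colspace X"
  shows "quad w (y + z) = quad w y"
proof -
  obtain \<gamma> where "z = X *v \<gamma>" using assms by (auto simp: colspace_eq_range)
  then show ?thesis using quad_equivariant[of 1 w y \<gamma>] by simp
qed

lemma continuous_on_quad:
  "continuous_on (UNIV \<times> (- Nstar N \<Omega>)) (\<lambda>(w, y). w \<bullet> (matrix_inv (\<Omega> y) *v w))"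
proof -
  have "continuous_on (UNIV \<times> (- Nstar N \<Omega>)) (\<lambda>p :: (real^'q) \<times> (real^'n). \<Omega> (snd p))"
    by (rule continuous_on_compose2[OF cont_\<Omega>]) (auto intro: continuous_intros simp: Nstar_def)
  then show ?thesis unfolding case_prod_beta
    by (intro continuous_intros continuous_on_matrix_inv_mult) (auto dest: notin_NstarD)
qed

lemma borel_measurable_quad [measurable]: "(\<lambda>p. quad (fst p) (snd p)) \<in> borel_measurable borel"
proof -
  have "(\<lambda>p. if p \<in> UNIV \<times> (- Nstar N \<Omega>) then (\<lambda>(w, y). w \<bullet> (matrix_inv (\<Omega> y) *v w)) p else 0)
      \<in> borel_measurable (borel :: ((real^'q) \<times> (real^'n)) measure)"
    using open_Compl_Nstar
    by (intro borel_measurable_continuous_on_if continuous_on_quad) (auto intro!: borel_open open_Times)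
  then show ?thesis
    by (rule measurable_cong[THEN iffD1, rotated]) (auto simp: quad_def)
qed

lemma borel_measurable_quad_comp:
  assumes "f \<in> borel_measurable M" "g \<in> borel_measurable M"
  shows "(\<lambda>x. quad (f x) (g x)) \<in> borel_measurable M"
  using measurable_compose[OF borel_measurable_Pair[OF assms] borel_measurable_quad] by simp

lemma tendsto_quad:
  assumes y: "y \<longlonglongrightarrow> y'" "y' \<notin> Nstar N \<Omega>" and w: "w \<longlonglongrightarrow> w'"
  shows "(\<lambda>m. quad (w m) (y m)) \<longlonglongrightarrow> quad w' y'"
proof -
  let ?U = "UNIV \<times> (- Nstar N \<Omega>) :: ((real^'q) \<times> (real^'n)) set"
  let ?f = "\<lambda>(w, y). w \<bullet> (matrix_inv (\<Omega> y) *v w)"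
  have "open ?U" using open_Compl_Nstar by (simp add: open_Times)
  then have "continuous (at (w', y')) ?f"
    using continuous_on_quad y(2) by (simp add: continuous_on_eq_continuous_at)
  then have "(\<lambda>m. ?f (w m, y m)) \<longlonglongrightarrow> ?f (w', y')"
    by (rule continuous_within_tendsto_compose') (use tendsto_Pair[OF w y(1)] in auto)
  moreover have "\<forall>\<^sub>F m in sequentially. y m \<in> - Nstar N \<Omega>"
    using topological_tendstoD[OF y(1) open_Compl_Nstar] y(2) by simp
  then have "\<forall>\<^sub>F m in sequentially. ?f (w m, y m) = quad (w m) (y m)"
    by eventually_elim (simp add: quad_def)
  ultimately show ?thesis using y(2) by (auto simp: quad_def intro: Lim_transform_eventually)
qed

lemma tendsto_\<beta>:
  assumes "y \<longlonglongrightarrow> y'" "y' \<notin> Nstar N \<Omega>"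
  shows "(\<lambda>m. \<beta> (y m)) \<longlonglongrightarrow> \<beta> y'"
proof -
  have "continuous (at y') \<beta>"
    using cont_\<beta> closed_N notin_NstarD(1)[OF assms(2)] by (simp add: continuous_on_eq_continuous_at open_Compl)
  then show ?thesis using assms(1) by (rule isCont_tendsto_compose)
qed

lemma borel_measurable_test_stat [measurable]: "test_stat R r N \<beta> \<Omega> \<in> borel_measurable borel"
proof -
  \<comment> \<open>The estimator is arbitrary on \<open>N\<close>; resetting it to \<open>0\<close> does not affect the statistic.\<close>
  have "continuous_on (- Nstar N \<Omega>) \<beta>" by (rule continuous_on_subset[OF cont_\<beta>]) (auto simp: Nstar_def)
  then have "(\<lambda>y. if y \<in> - Nstar N \<Omega> then \<beta> y else 0) \<in> borel_measurable borel"
    by (intro borel_measurable_continuous_on_if) auto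
  then have "(\<lambda>y. quad (R *v (if y \<in> - Nstar N \<Omega> then \<beta> y else 0) - r) y) \<in> borel_measurable borel"
    by (intro borel_measurable_quad_comp borel_measurable_diff measurable_compose[OF _ matrix_vector_mult_measurable]) auto
  also have "(\<lambda>y. quad (R *v (if y \<in> - Nstar N \<Omega> then \<beta> y else 0) - r) y) = test_stat R r N \<beta> \<Omega>"
    by (auto simp: fun_eq_iff test_stat_eq_quad quad_def)
  finally show ?thesis .
qed

lemma borel_rejection_region [measurable]: "rejection_region R r N \<beta> \<Omega> C \<in> sets borel"
  unfolding rejection_region_def by measurable

text \<open>The exceptional set and the zero set of the form outside of it are null sets, and the preimage of a null
set under an invertible linear map is again one.\<close>

lemma AE_quad_nonzero:
  fixes F :: "real^'n^'n"
  assumes "v \<noteq> 0" "invertible F"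
  shows "AE g in std_gauss. quad v (F *v g) \<noteq> 0"
proof -
  have "AE g in std_gauss. F *v g \<notin> Nstar N \<Omega>"
    by (rule AE_std_gauss_invertible_image[OF assms(2) null_Nstar])
  moreover have "AE g in std_gauss. F *v g \<notin> {y. y \<notin> Nstar N \<Omega> \<and> v \<bullet> (matrix_inv (\<Omega> y) *v v) = 0}"
    by (rule AE_std_gauss_invertible_image[OF assms(2) nondegenerate[OF assms(1)]])
  ultimately show ?thesis by eventually_elim (simp add: quad_def)
qed

text \<open>Both the scaling by \<open>t\<close> and the shift along the span of \<open>X\<close> move out of the statistic. The vector \<open>b\<close>, which
represents the mean under the null hypothesis, cancels against \<open>r\<close>.\<close>

lemma test_stat_rescale:
  assumes r: "R *v b = r" and t: "t > 0"
  shows "test_stat R r N \<beta> \<Omega> (t *\<^sub>R x + X *v (b + \<gamma>)) = quad (t *\<^sub>R (R *v \<beta> x) + R *v \<gamma>) x / t\<^sup>2"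
proof (cases "x \<in> Nstar N \<Omega>")
  case True
  then show ?thesis using t by (simp add: test_stat_eq_quad quad_def Nstar_equivariant)
next
  case False
  have "R *v \<beta> (t *\<^sub>R x + X *v (b + \<gamma>)) - r = t *\<^sub>R (R *v \<beta> x) + R *v \<gamma>"
    using equivariant(2)[OF notin_NstarD(1)[OF False], of t "b + \<gamma>"] t r
    by (simp add: matrix_vector_right_distrib matrix_vector_mult_scaleR)
  then show ?thesis using t by (simp add: test_stat_eq_quad quad_equivariant)
qed

text \<open>The common limit theorem behind both outer inequalities. The argument of the statistic is an element of
the span of \<open>X\<close> plus \<open>t x\<close> with \<open>x = F m g\<close> and \<open>t = \<sigma> sqrt (s m)\<close>, because
\<open>P x + sqrt (s m) (x - P x) = sqrt (s m) x + (1 - sqrt (s m)) P x\<close>. After division by the scale \<open>d m\<close> the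
coefficient of \<open>\<beta>(x)\<close> and the threshold carry a factor that tends to \<open>0\<close> with \<open>s m\<close>. The limits \<open>a\<close> and
\<open>e\<close> are the weights that remain for the mean shift \<open>z\<close> and for the random component \<open>P x\<close>.\<close>

lemma tendsto_prob_test_stat:
  fixes F :: "nat \<Rightarrow> real^'n^'n"
  assumes F: "F \<longlonglongrightarrow> F'" and P: "\<And>x. P *v x \<in> colspace X"
    and s: "\<And>m. s m > 0" "s \<longlonglongrightarrow> 0" and \<sigma>: "\<sigma> > 0"
    and d: "\<And>m. d m > 0" "(\<lambda>m. c m / d m) \<longlonglongrightarrow> a" "(\<lambda>m. \<sigma> / d m) \<longlonglongrightarrow> e"
    and z: "z \<in> colspace X" and b: "R *v b = r"
    and nz: "AE g in std_gauss. quad (R *v ols X (a *\<^sub>R z + e *\<^sub>R (P *v (F' *v g)))) (F' *v g) \<noteq> 0"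
  shows "(\<lambda>m. measure std_gauss {g. test_stat R r N \<beta> \<Omega>
             (X *v b + c m *\<^sub>R z + \<sigma> *\<^sub>R ((P + sqrt (s m) *\<^sub>R (mat 1 - P)) *v (F m *v g))) \<ge> C})
    \<longlonglongrightarrow> measure std_gauss {g. quad (R *v ols X (a *\<^sub>R z + e *\<^sub>R (P *v (F' *v g)))) (F' *v g) \<ge> 0}"
    (is "(\<lambda>m. measure _ {g. test_stat R r N \<beta> \<Omega> (?y m g) \<ge> C}) \<longlonglongrightarrow> measure _ {g. ?q g \<ge> 0}")
proof -
  define w where "w m g = (\<sigma> / d m * sqrt (s m)) *\<^sub>R (R *v \<beta> (F m *v g))
      + R *v ((c m / d m) *\<^sub>R ols X z + (\<sigma> / d m * (1 - sqrt (s m))) *\<^sub>R ols X (P *v (F m *v g)))" for m g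
  have lin: "linear (ols X)" by (simp add: ols_eq_matrix matrix_vector_mul_linear)
  have yw: "test_stat R r N \<beta> \<Omega> (?y m g) \<ge> C \<longleftrightarrow> quad (w m g) (F m *v g) \<ge> C * s m * (\<sigma> / d m)\<^sup>2" for m g
  proof -
    define x where "x = F m *v g"
    define t where "t = \<sigma> * sqrt (s m)"
    have t: "t > 0" using s(1) \<sigma> by (simp add: t_def)
    have t2: "t\<^sup>2 = \<sigma>\<^sup>2 * s m" using s(1)[of m] by (simp add: t_def power_mult_distrib)
    define \<gamma> where "\<gamma> = c m *\<^sub>R ols X z + (\<sigma> * (1 - sqrt (s m))) *\<^sub>R ols X (P *v x)"
    have "X *v \<gamma> = c m *\<^sub>R z + (\<sigma> * (1 - sqrt (s m))) *\<^sub>R (P *v x)"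
      by (simp add: \<gamma>_def matrix_vector_right_distrib matrix_vector_mult_scaleR mult_ols_in_colspace[OF inj_X] z P)
    then have "?y m g = t *\<^sub>R x + X *v (b + \<gamma>)"
      by (simp add: x_def t_def matrix_vector_right_distrib matrix_vector_mult_add_rdistrib
          matrix_vector_mult_diff_rdistrib scaleR_matrix_vector_assoc[symmetric] algebra_simps)
    then have "test_stat R r N \<beta> \<Omega> (?y m g) = quad (t *\<^sub>R (R *v \<beta> x) + R *v \<gamma>) x / t\<^sup>2"
      using test_stat_rescale[OF b t] by simp
    moreover have "t *\<^sub>R (R *v \<beta> x) + R *v \<gamma> = d m *\<^sub>R w m g"
      using d(1)[of m] by (simp add: w_def \<gamma>_def x_def t_def matrix_vector_right_distrib
          matrix_vector_mult_scaleR scaleR_add_right)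
    ultimately have "test_stat R r N \<beta> \<Omega> (?y m g) = (d m)\<^sup>2 * quad (w m g) x / (\<sigma>\<^sup>2 * s m)"
      by (simp add: quad_scale_left t2)
    moreover have "C \<le> (d m)\<^sup>2 * q / (\<sigma>\<^sup>2 * s m) \<longleftrightarrow> C * s m * (\<sigma> / d m)\<^sup>2 \<le> q" for q
      using d(1)[of m] s(1)[of m] \<sigma> by (simp add: field_simps power2_eq_square)
    ultimately show ?thesis by (simp add: x_def)
  qed
  have Fg: "(\<lambda>m. F m *v g) \<longlonglongrightarrow> F' *v g" for g
    unfolding matrix_vector_mult_def
    by (intro tendsto_vec_lambda tendsto_sum tendsto_mult tendsto_const tendsto_vec_nth F)
  have s0: "(\<lambda>m. sqrt (s m)) \<longlonglongrightarrow> 0" using tendsto_real_sqrt[OF s(2)] by simp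
  have w_lim: "(\<lambda>m. w m g) \<longlonglongrightarrow> R *v ols X (a *\<^sub>R z + e *\<^sub>R (P *v (F' *v g)))"
    if "F' *v g \<notin> Nstar N \<Omega>" for g
  proof -
    have cont: "(\<lambda>m. A *v v m) \<longlonglongrightarrow> A *v v'" if "v \<longlonglongrightarrow> v'" for A :: "real^'i^'j" and v v'
      using that by (rule bounded_linear.tendsto[OF matrix_vector_mul_bounded_linear])
    have "(\<lambda>m. w m g) \<longlonglongrightarrow> (e * 0) *\<^sub>R (R *v \<beta> (F' *v g)) +
        R *v (a *\<^sub>R ols X z + (e * (1 - 0)) *\<^sub>R ols X (P *v (F' *v g)))"
      unfolding w_def ols_eq_matrix
      by (intro tendsto_add tendsto_scaleR tendsto_mult tendsto_diff tendsto_const cont d s0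
          tendsto_\<beta>[OF Fg that] Fg)
    then show ?thesis by (simp add: linear_add[OF lin] linear_scale[OF lin])
  qed
  have "(\<lambda>m. measure std_gauss {g \<in> space std_gauss. quad (w m g) (F m *v g) \<ge> C * s m * (\<sigma> / d m)\<^sup>2})
      \<longlonglongrightarrow> measure std_gauss {g \<in> space std_gauss. ?q g \<ge> 0}"
  proof (rule measure_tendsto_if_AE_nonzero_limit[OF prob_space_std_gauss])
    show "{g \<in> space std_gauss. quad (w m g) (F m *v g) \<ge> C * s m * (\<sigma> / d m)\<^sup>2} \<in> sets std_gauss" for m
      unfolding yw[symmetric] by measurable
    have "?q \<in> borel_measurable borel"
      unfolding ols_eq_matrix by (intro borel_measurable_quad_comp) measurable
    then show "{g \<in> space std_gauss. ?q g \<ge> 0} \<in> sets std_gauss" by measurable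
    have "(\<lambda>m. C * s m * (\<sigma> / d m)\<^sup>2) \<longlonglongrightarrow> C * 0 * e\<^sup>2"
      by (intro tendsto_intros s d)
    then show "(\<lambda>m. C * s m * (\<sigma> / d m)\<^sup>2) \<longlonglongrightarrow> 0" by simp
    show "AE g in std_gauss. ?q g \<noteq> 0 \<and> (\<lambda>m. quad (w m g) (F m *v g)) \<longlonglongrightarrow> ?q g"
      using nz
    proof eventually_elim
      case (elim g)
      then have "F' *v g \<notin> Nstar N \<Omega>" by (auto simp: quad_def)
      then show ?case using elim tendsto_quad[OF Fg _ w_lim] by simp
    qed
  qed
  then show ?thesis by (simp add: yw)
qed

end

section \<open>Blockwise rescaling of the covariance matrices\<close>

lemmas matrix_vector_expand = matrix_vector_mul_assoc[symmetric] matrix_vector_right_distrib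
  matrix_vector_mult_add_rdistrib matrix_vector_mult_diff_distrib matrix_vector_mult_diff_rdistrib
  scaleR_matrix_vector_assoc[symmetric] matrix_vector_mult_scaleR

locale singular_limit =
  fixes Sig :: "nat \<Rightarrow> real^'n^'n" and Sbar :: "real^'n^'n" and s :: "nat \<Rightarrow> real" and D :: "real^'n^'n"
    and L :: "(real^'n) set"
  assumes L: "L = colspace Sbar"
    and Sig: "\<And>m. symmetric_mat (Sig m)" "\<And>m. pos_def_mat (Sig m)"
    and Sig_lim: "Sig \<longlonglongrightarrow> Sbar" and singular: "\<not> invertible Sbar"
    and s_pos: "\<And>m. s m > 0"
    and D_lim: "(\<lambda>m. (proj_mat (orthogonal_comp L) ** Sig m ** proj_mat (orthogonal_comp L)) /\<^sub>R s m) \<longlonglongrightarrow> D"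
    and D_inj: "inj_on ((*v) D) (orthogonal_comp L)"
    and cross_lim: "(\<lambda>m. (proj_mat (orthogonal_comp L) ** Sig m ** proj_mat L) /\<^sub>R sqrt (s m)) \<longlonglongrightarrow> 0"

begin

definition P where "P = proj_mat L"

definition Q where "Q = mat 1 - P"

definition \<Gamma> where "\<Gamma> = Sbar + D"

text \<open>The scalings \<open>blow_up m\<close> and \<open>shrink m\<close> are inverse to each other and leave \<open>L\<close> fixed. The first one
compensates the decay of the covariance in the directions orthogonal to \<open>L\<close>.\<close>

definition blow_up where "blow_up m = P + (1 / sqrt (s m)) *\<^sub>R Q"

definition shrink where "shrink m = P + sqrt (s m) *\<^sub>R Q"

lemma subspace_L: "subspace L"
  by (simp add: L colspace_def)

lemma Q_eq: "Q = proj_mat (orthogonal_comp L)"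
  by (simp add: Q_def P_def proj_mat_orthogonal_comp subspace_L)

lemma P_sym: "symmetric_mat P" and P_idem: "P ** P = P"
  by (simp_all add: P_def symmetric_proj_mat proj_mat_idem subspace_L)

lemma Q_sym: "symmetric_mat Q"
  by (simp add: Q_eq symmetric_proj_mat subspace_orthogonal_comp)

lemma P_in: "P *v x \<in> L" and Q_in: "Q *v x \<in> orthogonal_comp L"
  and P_fix: "x \<in> L \<Longrightarrow> P *v x = x"
  using proj_mat[OF subspace_L] proj_mat_in[OF subspace_L]
  by (auto simp: P_def Q_def matrix_vector_mult_diff_rdistrib)

lemma PP: "P *v (P *v x) = P *v x" and PQ: "P *v (Q *v x) = 0" and QP: "Q *v (P *v x) = 0"
  and QQ: "Q *v (Q *v x) = Q *v x" and PQ_sum: "P *v x + Q *v x = x"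
  by (simp_all add: P_fix P_in Q_def matrix_vector_expand)

lemma shrink_blow_up: "shrink m ** blow_up m = mat 1" "blow_up m ** shrink m = mat 1"
  using s_pos[of m] unfolding matrix_eq shrink_def blow_up_def
  by (simp_all add: matrix_vector_expand PP PQ QP QQ PQ_sum)

lemma blow_up_shrink_sym: "symmetric_mat (blow_up m)" "symmetric_mat (shrink m)"
  by (rule symmetric_matI; simp add: blow_up_def shrink_def matrix_vector_expand inner_add_left inner_add_right
      symmetric_mat_inner[OF P_sym] symmetric_mat_inner[OF Q_sym])+

lemma Sbar: "symmetric_mat Sbar" "nonneg_def_mat Sbar"
  using symmetric_nonneg_limit[OF Sig_lim Sig(1) nonneg_if_pos_def_mat[OF Sig(2)]] by auto

lemma D: "symmetric_mat D" "nonneg_def_mat D"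
proof -
  have "symmetric_mat ((Q ** Sig m ** Q) /\<^sub>R s m)" "nonneg_def_mat ((Q ** Sig m ** Q) /\<^sub>R s m)" for m
    using congruence_symmetric_nonneg[OF Sig(1) nonneg_if_pos_def_mat[OF Sig(2)] Q_sym, of m] s_pos[of m]
    by (auto simp: symmetric_mat_def nonneg_def_mat_def scaleR_matrix_vector_assoc[symmetric]
        transpose_def vec_eq_iff)
  with symmetric_nonneg_limit[OF D_lim[folded Q_eq]] show "symmetric_mat D" "nonneg_def_mat D" by auto
qed

text \<open>For a symmetric matrix the kernel is the orthogonal complement of the range.\<close>

lemma Sbar_eq_0_iff: "Sbar *v x = 0 \<longleftrightarrow> x \<in> orthogonal_comp L"
proof
  assume "Sbar *v x = 0"
  then show "x \<in> orthogonal_comp L"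
    by (auto simp: orthogonal_comp_def orthogonal_def L colspace_eq_range symmetric_mat_inner[OF Sbar(1)])
next
  assume "x \<in> orthogonal_comp L"
  then have "(Sbar *v (Sbar *v x)) \<bullet> x = 0"
    by (auto simp: orthogonal_comp_def orthogonal_def L colspace_eq_range)
  then show "Sbar *v x = 0" by (metis inner_eq_zero_iff symmetric_mat_inner[OF Sbar(1)])
qed

lemma Sbar_Q: "Sbar *v (Q *v x) = 0"
  using Sbar_eq_0_iff Q_in by blast

lemma Sbar_in: "Sbar *v x \<in> L"
  by (simp add: L colspace_eq_range)

lemma D_P: "D *v (P *v x) = 0"
proof -
  have "(\<lambda>m. ((Q ** Sig m ** Q) /\<^sub>R s m) ** P) \<longlonglongrightarrow> D ** P"
    by (intro tendsto_matrix_mult D_lim[folded Q_eq] tendsto_const)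
  moreover have "((Q ** Sig m ** Q) /\<^sub>R s m) ** P = 0" for m
    unfolding matrix_eq by (simp add: matrix_vector_expand QP)
  ultimately have "D ** P = 0" by (simp add: LIMSEQ_const_iff)
  then show ?thesis by (simp add: matrix_vector_mul_assoc)
qed

text \<open>If both quadratic forms vanish at \<open>x\<close>, then \<open>x\<close> is orthogonal to \<open>L\<close> and is annihilated by \<open>D\<close>, which is
injective there.\<close>

lemma \<Gamma>: "symmetric_mat \<Gamma>" "pos_def_mat \<Gamma>"
proof -
  show "symmetric_mat \<Gamma>"
    by (rule symmetric_matI) (simp add: \<Gamma>_def matrix_vector_expand inner_add_left inner_add_right
        symmetric_mat_inner[OF Sbar(1)] symmetric_mat_inner[OF D(1)])
  have "x \<bullet> (\<Gamma> *v x) > 0" if "x \<noteq> 0" for x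
  proof (rule ccontr)
    assume "\<not> ?thesis"
    moreover have "x \<bullet> (Sbar *v x) \<ge> 0" "x \<bullet> (D *v x) \<ge> 0"
      using Sbar(2) D(2) by (auto simp: nonneg_def_mat_def)
    ultimately have "x \<bullet> (Sbar *v x) = 0" "x \<bullet> (D *v x) = 0"
      by (auto simp: \<Gamma>_def matrix_vector_expand inner_add_right)
    then have "x \<in> orthogonal_comp L" "D *v x = D *v 0"
      using mat_kernel_if_quadratic_zero[OF Sbar] mat_kernel_if_quadratic_zero[OF D] Sbar_eq_0_iff by auto
    then show False
      using D_inj that subspace_0[OF subspace_orthogonal_comp] by (metis inj_onD)
  qed
  then show "pos_def_mat \<Gamma>" by (simp add: pos_def_mat_def)
qed

lemma sqrt_Sbar_Q: "sqrt_mat Sbar *v (Q *v x) = 0"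
  by (intro sqrt_mat_kernel[OF Sbar]) (simp add: Sbar_Q)

lemma sqrt_D_P: "sqrt_mat D *v (P *v x) = 0"
  by (intro sqrt_mat_kernel[OF D]) (simp add: D_P)

lemma sqrt_Sbar_P: "sqrt_mat Sbar *v (P *v x) = sqrt_mat Sbar *v x"
  by (metis PQ_sum add.right_neutral matrix_vector_right_distrib sqrt_Sbar_Q)

lemma P_sqrt_Sbar: "P *v (sqrt_mat Sbar *v x) = sqrt_mat Sbar *v x"
proof -
  have "(P *v (sqrt_mat Sbar *v x)) \<bullet> y = (sqrt_mat Sbar *v x) \<bullet> y" for y
    by (simp add: symmetric_mat_inner[OF P_sym] symmetric_mat_inner[OF sqrt_mat(1)[OF Sbar]] sqrt_Sbar_P)
  then show ?thesis by (metis vector_eq_rdot)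
qed

lemma P_sqrt_D: "P *v (sqrt_mat D *v x) = 0"
proof -
  have "(P *v (sqrt_mat D *v x)) \<bullet> y = 0 \<bullet> y" for y
    by (simp add: symmetric_mat_inner[OF P_sym] symmetric_mat_inner[OF sqrt_mat(1)[OF D]] sqrt_D_P)
  then show ?thesis by (metis vector_eq_rdot)
qed

text \<open>The two roots annihilate each other, since one maps into \<open>L\<close> and the other one vanishes on \<open>L\<close> and maps
into its complement. Hence the square of their sum has no cross terms.\<close>

lemma sqrt_\<Gamma>: "sqrt_mat \<Gamma> = sqrt_mat Sbar + sqrt_mat D"
proof (rule sqrt_mat_unique)
  let ?S = "sqrt_mat Sbar" and ?T = "sqrt_mat D"
  note S = sqrt_mat[OF Sbar] and T = sqrt_mat[OF D]
  show "symmetric_mat (?S + ?T)"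
    by (rule symmetric_matI) (simp add: matrix_vector_expand inner_add_left inner_add_right
        symmetric_mat_inner[OF S(1)] symmetric_mat_inner[OF T(1)])
  show "nonneg_def_mat (?S + ?T)"
    using S(2) T(2) by (simp add: nonneg_def_mat_def matrix_vector_expand inner_add_right)
  have ST: "?S *v (?T *v x) = 0" for x
    using sqrt_Sbar_P[of "?T *v x"] by (simp add: P_sqrt_D)
  have TS: "?T *v (?S *v x) = 0" for x
    using sqrt_D_P[of "?S *v x"] by (simp add: P_sqrt_Sbar)
  show "(?S + ?T) ** (?S + ?T) = \<Gamma>"
    using S(3) T(3) unfolding matrix_eq \<Gamma>_def by (simp add: matrix_vector_expand ST TS)
qed

lemma P_sqrt_\<Gamma>: "P *v (sqrt_mat \<Gamma> *v x) = sqrt_mat Sbar *v x"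
  by (simp add: sqrt_\<Gamma> matrix_vector_expand P_sqrt_Sbar P_sqrt_D)

lemma invertible_sqrt_\<Gamma>: "invertible (sqrt_mat \<Gamma>)"
  by (rule pos_def_mat_sqrt(1)[OF \<Gamma>])

text \<open>The block \<open>Q Sig Q\<close> tends to \<open>Q Sbar Q = 0\<close>, whereas its quotient by \<open>s m\<close> tends to \<open>D \<noteq> 0\<close>.\<close>

lemma s_lim: "s \<longlonglongrightarrow> 0"
proof -
  have "\<not> (\<forall>x. Sbar *v x = 0 \<longrightarrow> x = 0)"
    using singular invertible_if_kernel_trivial by blast
  then obtain x where x: "x \<noteq> 0" "x \<in> orthogonal_comp L" using Sbar_eq_0_iff by blast
  have "D *v x \<noteq> D *v 0"
    using D_inj x subspace_0[OF subspace_orthogonal_comp] by (metis inj_onD)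
  then have D0: "norm D \<noteq> 0" by auto
  have "Q ** Sbar ** Q = 0"
    unfolding matrix_eq by (simp add: matrix_vector_expand Sbar_Q)
  then have QSQ: "(\<lambda>m. Q ** Sig m ** Q) \<longlonglongrightarrow> 0"
    using tendsto_matrix_mult[OF tendsto_matrix_mult[OF tendsto_const[of Q] Sig_lim] tendsto_const[of Q]] by simp
  let ?D = "\<lambda>m. (Q ** Sig m ** Q) /\<^sub>R s m"
  have normD: "(\<lambda>m. norm (?D m)) \<longlonglongrightarrow> norm D" by (intro tendsto_norm D_lim[folded Q_eq])
  have "(\<lambda>m. norm (Q ** Sig m ** Q) / norm (?D m)) \<longlonglongrightarrow> norm (0 :: real^'n^'n) / norm D"
    by (intro tendsto_divide tendsto_norm QSQ normD D0)
  moreover have "\<forall>\<^sub>F m in sequentially. norm (?D m) \<noteq> 0"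
    using normD D0 by (rule tendsto_imp_eventually_ne)
  then have "\<forall>\<^sub>F m in sequentially. norm (Q ** Sig m ** Q) / norm (?D m) = s m"
  proof eventually_elim
    case (elim m)
    then show ?case using s_pos[of m] by (simp add: field_simps)
  qed
  ultimately show ?thesis by (auto intro: Lim_transform_eventually)
qed

definition Gam where "Gam m = blow_up m ** Sig m ** blow_up m"

lemma Gam: "symmetric_mat (Gam m)" "nonneg_def_mat (Gam m)"
  using congruence_symmetric_nonneg[OF Sig(1) nonneg_if_pos_def_mat[OF Sig(2)] blow_up_shrink_sym(1)]
  by (auto simp: Gam_def)

text \<open>Expanding the product into four blocks gives \<open>P Sig P\<close>, which tends to \<open>Sbar\<close>, the block over
\<open>s m\<close> that tends to \<open>D\<close>, and the two mixed blocks over \<open>sqrt (s m)\<close>, transposes of each other, which tend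
to \<open>0\<close>.\<close>

lemma Gam_lim: "Gam \<longlonglongrightarrow> \<Gamma>"
proof -
  let ?C = "\<lambda>m. (Q ** Sig m ** P) /\<^sub>R sqrt (s m)"
  have C: "?C \<longlonglongrightarrow> 0" using cross_lim by (simp add: Q_eq P_def)
  have "(\<lambda>m. P ** Sig m ** P + (transpose (?C m) + ?C m) + (Q ** Sig m ** Q) /\<^sub>R s m)
      \<longlonglongrightarrow> P ** Sbar ** P + (transpose 0 + 0) + D"
    by (intro tendsto_add tendsto_matrix_mult tendsto_const Sig_lim tendsto_matrix_transpose C D_lim[folded Q_eq])
  moreover have "P ** Sbar ** P + (transpose 0 + 0) + D = \<Gamma>"
  proof -
    have "Sbar *v (P *v x) = Sbar *v x" for x
      by (metis PQ_sum Sbar_Q add.right_neutral matrix_vector_right_distrib)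
    then have "P ** Sbar ** P = Sbar"
      unfolding matrix_eq by (simp add: matrix_vector_mul_assoc[symmetric] P_fix Sbar_in)
    moreover have "transpose (0 :: real^'n^'n) = 0" by (simp add: transpose_def vec_eq_iff)
    ultimately show ?thesis by (simp add: \<Gamma>_def)
  qed
  moreover have "P ** Sig m ** P + (transpose (?C m) + ?C m) + (Q ** Sig m ** Q) /\<^sub>R s m = Gam m" for m
  proof -
    have "transpose (?C m) = (P ** Sig m ** Q) /\<^sub>R sqrt (s m)"
    proof -
      have "transpose (?C m) = transpose (Q ** Sig m ** P) /\<^sub>R sqrt (s m)"
        by (simp add: transpose_def vec_eq_iff)
      then show ?thesis
        using P_sym Q_sym Sig(1)[of m] by (simp add: matrix_transpose_mul symmetric_mat_def matrix_mul_assoc)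
    qed
    then show ?thesis
      using s_pos[of m] unfolding matrix_eq Gam_def blow_up_def
      by (simp add: matrix_vector_expand inverse_eq_divide algebra_simps)
  qed
  ultimately show ?thesis by simp
qed

lemma sqrt_Gam_lim: "(\<lambda>m. sqrt_mat (Gam m)) \<longlonglongrightarrow> sqrt_mat \<Gamma>"
  by (rule tendsto_sqrt_mat[OF Gam_lim Gam \<Gamma>])

text \<open>The matrix \<open>\<sigma> shrink m sqrt_mat (Gam m)\<close> is a factor of the covariance \<open>\<sigma>\<^sup>2 Sig m\<close>. Unlike the root of
\<open>Sig m\<close> it separates the degenerating scaling from a convergent sequence of matrices.\<close>

lemma gaussian_Sig:
  assumes "\<sigma> > 0"
  shows "gaussian \<mu> (\<sigma>\<^sup>2 *\<^sub>R Sig m)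
    = distr std_gauss borel (\<lambda>g. \<mu> + \<sigma> *\<^sub>R (shrink m *v (sqrt_mat (Gam m) *v g)))"
proof -
  let ?S = "sqrt_mat (Gam m)"
  note S = sqrt_mat[OF Gam, of m]
  define F where "F = \<sigma> *\<^sub>R (shrink m ** ?S)"
  have "transpose F = \<sigma> *\<^sub>R (?S ** shrink m)"
  proof -
    have "transpose F = \<sigma> *\<^sub>R transpose (shrink m ** ?S)" by (simp add: F_def transpose_def vec_eq_iff)
    then show ?thesis using S(1) blow_up_shrink_sym(2)[of m] by (simp add: matrix_transpose_mul symmetric_mat_def)
  qed
  then have "(F ** transpose F) *v x = (\<sigma>\<^sup>2 *\<^sub>R Sig m) *v x" for x
  proof -
    have "?S *v (?S *v y) = blow_up m *v (Sig m *v (blow_up m *v y))" for y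
      by (metis S(3) Gam_def matrix_vector_mul_assoc)
    moreover have "shrink m *v (blow_up m *v y) = y" "blow_up m *v (shrink m *v y) = y" for y
      by (simp_all add: matrix_vector_mul_assoc shrink_blow_up)
    ultimately show ?thesis using \<open>transpose F = _\<close>
      by (simp add: F_def matrix_vector_expand power2_eq_square del: transpose_matrix_vector)
  qed
  then have FF: "F ** transpose F = \<sigma>\<^sup>2 *\<^sub>R Sig m" by (simp add: matrix_eq)
  have pd: "pos_def_mat (\<sigma>\<^sup>2 *\<^sub>R Sig m)"
    using Sig(2)[of m] assms by (simp add: pos_def_mat_def scaleR_matrix_vector_assoc[symmetric])
  have "F *v g = \<sigma> *\<^sub>R (shrink m *v (?S *v g))" for g by (simp add: F_def matrix_vector_expand)
  then show ?thesis using gaussian_eq_distr_std_gauss[OF FF pd, of \<mu>] by simp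
qed

end

section \<open>Limits of the rejection probabilities\<close>

text \<open>A linear map that is nonzero somewhere on \<open>L\<close> is nonzero almost everywhere on \<open>L\<close>, so \<open>ex_nz\<close> expresses
the condition that \<open>R ols X z\<close> is almost never zero on \<open>L\<close>.\<close>

locale singular_test = equivariant_test X R r N \<beta> \<Omega> + singular_limit Sig Sbar s D L
  for X :: "real^'k^'n" and R :: "real^'k^'q" and r N \<beta> \<Omega>
    and Sig :: "nat \<Rightarrow> real^'n^'n" and Sbar s D L +
  fixes Z :: "real^'l^'n"
  assumes L_sub: "L \<subseteq> colspace X" and Z: "inj ((*v) Z)" "colspace Z = L"
    and ex_nz: "\<exists>z\<in>L. R *v ols X z \<noteq> 0"

begin

definition root_Sbar where "root_Sbar = sqrt_mat Sbar"

definition root_\<Gamma> where "root_\<Gamma> = sqrt_mat \<Gamma>"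

text \<open>The probability that the limit variable is nonnegative, as a function of \<open>z = Z \<gamma>\<close>.\<close>

definition limit_prob :: "real^'n \<Rightarrow> real" where
  "limit_prob z = measure std_gauss {g. quad (R *v ols X z) (root_\<Gamma> *v g) \<ge> 0}"

lemma linear_R_ols: "linear (\<lambda>z. R *v ols X z)"
  unfolding ols_eq_matrix by (simp add: matrix_vector_mul_assoc)

lemma measurable_R_ols [measurable]: "(\<lambda>z. R *v ols X z) \<in> borel_measurable borel"
  unfolding ols_eq_matrix matrix_vector_mul_assoc by measurable

lemma borel_quad_R_ols:
  assumes A: "A \<in> sets borel"
  shows "{p. quad (R *v ols X (fst p)) (snd p) \<in> A} \<in> sets borel"
proof -
  have "(\<lambda>p. quad (R *v ols X (fst p)) (snd p)) \<in> borel_measurable (borel \<Otimes>\<^sub>M borel)"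
    by (intro borel_measurable_quad_comp) measurable
  then have "(\<lambda>p. quad (R *v ols X (fst p)) (snd p)) \<in> borel_measurable borel"
    unfolding borel_prod .
  from measurable_sets_borel[OF this A] show ?thesis by (simp add: vimage_def)
qed

lemma borel_quad_root:
  assumes A: "A \<in> sets borel"
  shows "{g. quad v (root_\<Gamma> *v g) \<in> A} \<in> sets borel"
proof -
  have "(\<lambda>g. quad v (root_\<Gamma> *v g)) \<in> borel_measurable borel"
    by (intro borel_measurable_quad_comp) measurable
  from measurable_sets_borel[OF this A] show ?thesis by (simp add: vimage_def)
qed

lemma limit_prob_bounds: "0 \<le> limit_prob z" "limit_prob z \<le> 1"
  using prob_space.prob_le_1[OF prob_space_std_gauss] by (auto simp: limit_prob_def)

lemma measurable_limit_prob: "limit_prob \<in> borel_measurable borel"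
proof -
  let ?G = "std_gauss :: (real^'n) measure"
  interpret prob_space ?G by (rule prob_space_std_gauss)
  let ?H = "{p. quad (R *v ols X (fst p)) (root_\<Gamma> *v (snd p)) \<in> {0..}}"
  have "(\<lambda>p. quad (R *v ols X (fst p)) (root_\<Gamma> *v (snd p))) \<in> borel_measurable (borel \<Otimes>\<^sub>M borel)"
    by (intro borel_measurable_quad_comp) measurable
  from measurable_sets[OF this, of "{0..}"] have "?H \<in> sets (borel \<Otimes>\<^sub>M ?G)"
    by (simp add: vimage_def space_pair_measure cong: sets_pair_measure_cong)
  then have "(\<lambda>z. emeasure ?G (Pair z -` ?H)) \<in> borel_measurable borel"
    by (rule measurable_emeasure_Pair)
  then have "(\<lambda>z. enn2real (emeasure ?G (Pair z -` ?H))) \<in> borel_measurable borel" by measurable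
  then show ?thesis by (simp add: limit_prob_def[abs_def] measure_def vimage_def)
qed

lemma limit_prob_scale:
  assumes "c \<noteq> 0"
  shows "limit_prob (c *\<^sub>R z) = limit_prob z"
  using assms linear_scale[OF linear_R_ols] by (simp add: limit_prob_def quad_scale_left zero_le_mult_iff)

lemma limit_prob_eq_1:
  assumes "R *v ols X z = 0"
  shows "limit_prob z = 1"
  using prob_space.prob_space[OF prob_space_std_gauss] quad_scale_left[of 0 0]
  by (simp add: limit_prob_def assms)

text \<open>The vector of the form sees \<open>g\<close> only through \<open>root_Sbar\<close>, hence through \<open>P g\<close>, and the matrix of the form is
blind to \<open>P g\<close>, because \<open>root_\<Gamma>\<close> maps \<open>L\<close> into \<open>L\<close>, a part of the span of \<open>X\<close>.\<close>

lemma quad_decouple: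
  assumes A: "A \<in> sets borel"
  shows "emeasure std_gauss {g. quad (R *v ols X (root_Sbar *v g)) (root_\<Gamma> *v g) \<in> A}
    = (\<integral>\<^sup>+ g'. emeasure std_gauss {g. quad (R *v ols X (root_Sbar *v g')) (root_\<Gamma> *v g) \<in> A} \<partial>std_gauss)"
proof -
  have EP: "root_Sbar ** P = root_Sbar"
    unfolding matrix_eq root_Sbar_def by (simp add: matrix_vector_mul_assoc[symmetric] sqrt_Sbar_P)
  have "root_\<Gamma> *v (P *v u) \<in> colspace X" for u
  proof -
    have "root_\<Gamma> *v (P *v u) = root_Sbar *v (P *v u)"
      by (simp add: root_\<Gamma>_def root_Sbar_def sqrt_\<Gamma> matrix_vector_mult_add_rdistrib sqrt_D_P)
    also have "\<dots> = P *v (root_Sbar *v (P *v u))" by (simp add: root_Sbar_def P_sqrt_Sbar)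
    finally show ?thesis using P_in L_sub by auto
  qed
  then have "(z, x + root_\<Gamma> *v (P *v u)) \<in> {p. quad (R *v ols X (fst p)) (snd p) \<in> A}
      \<longleftrightarrow> (z, x) \<in> {p. quad (R *v ols X (fst p)) (snd p) \<in> A}" for z x u
    by (simp add: quad_add_colspace)
  from emeasure_std_gauss_decouple[OF P_sym P_idem EP borel_quad_R_ols[OF A] this] show ?thesis by simp
qed

lemma AE_R_ols_nonzero: "AE g in std_gauss. R *v ols X (root_Sbar *v g) \<noteq> 0"
proof -
  obtain z where z: "z \<in> L" "R *v ols X z \<noteq> 0" using ex_nz by blast
  then obtain x where "z = Sbar *v x" using L by (auto simp: colspace_eq_range)
  then have "z = root_Sbar *v (root_Sbar *v x)" using sqrt_mat(3)[OF Sbar] by (simp add: root_Sbar_def matrix_vector_mul_assoc)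
  then have "R *v ols X (root_Sbar *v (root_Sbar *v x)) \<noteq> 0" using z by simp
  moreover have "linear (\<lambda>g. R *v ols X (root_Sbar *v g))"
    using linear_compose[OF matrix_vector_mul_linear[of root_Sbar] linear_R_ols] by (simp add: comp_def)
  ultimately show ?thesis by (intro AE_std_gauss_not_in_kernel)
qed

text \<open>Vector and matrix of the form depend on the same \<open>g\<close>, so nondegeneracy, which concerns a fixed vector, does
not apply directly. After decoupling, the vector is fixed in the inner integral, and it is nonzero for
almost all values of the outer variable.\<close>

lemma AE_quad_nonzero_coupled: "AE g in std_gauss. quad (R *v ols X (root_Sbar *v g)) (root_\<Gamma> *v g) \<noteq> 0"
proof -
  have "(\<integral>\<^sup>+ g'. emeasure std_gauss {g. quad (R *v ols X (root_Sbar *v g')) (root_\<Gamma> *v g) \<in> {0}} \<partial>std_gauss) = (\<integral>\<^sup>+ g'. 0 \<partial>(std_gauss :: (real^'n) measure))"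
  proof (rule nn_integral_cong_AE)
    show "AE g' in std_gauss. emeasure std_gauss {g. quad (R *v ols X (root_Sbar *v g')) (root_\<Gamma> *v g) \<in> {0}} = 0"
      using AE_R_ols_nonzero
    proof eventually_elim
      case (elim g')
      have "AE g in std_gauss. quad (R *v ols X (root_Sbar *v g')) (root_\<Gamma> *v g) \<noteq> 0"
        unfolding root_\<Gamma>_def by (rule AE_quad_nonzero[OF elim invertible_sqrt_\<Gamma>])
      then have "AE g in std_gauss. g \<notin> {g. quad (R *v ols X (root_Sbar *v g')) (root_\<Gamma> *v g) \<in> {0}}" by simp
      then have "{g. quad (R *v ols X (root_Sbar *v g')) (root_\<Gamma> *v g) \<in> {0}} \<in> null_sets std_gauss"
        using AE_iff_null_sets[of "{g. quad (R *v ols X (root_Sbar *v g')) (root_\<Gamma> *v g) \<in> {0}}" std_gauss]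
          borel_quad_root[of "{0}"] by simp
      then show ?case by (rule null_setsD1)
    qed
  qed
  then have "emeasure std_gauss {g. quad (R *v ols X (root_Sbar *v g)) (root_\<Gamma> *v g) \<in> {0}} = 0"
    by (subst quad_decouple) auto
  moreover have "{g. quad (R *v ols X (root_Sbar *v g)) (root_\<Gamma> *v g) \<in> {0}} \<in> sets std_gauss"
  proof -
    have "(\<lambda>g. quad (R *v ols X (root_Sbar *v g)) (root_\<Gamma> *v g)) \<in> borel_measurable borel"
      by (intro borel_measurable_quad_comp) measurable
    from measurable_sets_borel[OF this, of "{0}"] show ?thesis by (simp add: vimage_def)
  qed
  ultimately have "AE g in std_gauss. g \<notin> {g. quad (R *v ols X (root_Sbar *v g)) (root_\<Gamma> *v g) \<in> {0}}"
    by (intro AE_not_in) (auto simp: null_sets_def)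
  then show ?thesis by simp
qed

lemma integral_limit_prob_root:
  "(\<integral>g'. limit_prob (root_Sbar *v g') \<partial>std_gauss)
    = measure std_gauss {g. quad (R *v ols X (root_Sbar *v g)) (root_\<Gamma> *v g) \<ge> 0}"
proof -
  interpret prob_space "std_gauss :: (real^'n) measure" by (rule prob_space_std_gauss)
  have "(\<integral>g'. limit_prob (root_Sbar *v g') \<partial>std_gauss)
      = enn2real (\<integral>\<^sup>+g'. ennreal (limit_prob (root_Sbar *v g')) \<partial>std_gauss)"
    using limit_prob_bounds(1) measurable_compose[OF matrix_vector_mult_measurable[of root_Sbar] measurable_limit_prob]
      measurable_cong_sets[OF sets_std_gauss refl, of borel]
    by (intro integral_eq_nn_integral) auto
  also have "(\<integral>\<^sup>+g'. ennreal (limit_prob (root_Sbar *v g')) \<partial>std_gauss)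
      = emeasure std_gauss {g. quad (R *v ols X (root_Sbar *v g)) (root_\<Gamma> *v g) \<in> {0..}}"
    by (subst quad_decouple) (simp_all add: limit_prob_def emeasure_eq_measure)
  finally show ?thesis by (simp add: measure_def)
qed

text \<open>The general limit theorem for the law of the observations. The weight \<open>a\<close> belongs to the shift of the mean
and the weight \<open>e\<close> to the random component in \<open>L\<close>.\<close>

lemma tendsto_rejection_prob:
  assumes "\<sigma> > 0" "R *v b = r" "z \<in> L"
    and d: "\<And>m. d m > 0" "(\<lambda>m. c m / d m) \<longlonglongrightarrow> a" "(\<lambda>m. \<sigma> / d m) \<longlonglongrightarrow> e"
    and nz: "AE g in std_gauss. quad (R *v ols X (a *\<^sub>R z + e *\<^sub>R (root_Sbar *v g))) (root_\<Gamma> *v g) \<noteq> 0"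
  shows "(\<lambda>m. measure (gaussian (X *v b + c m *\<^sub>R z) (\<sigma>\<^sup>2 *\<^sub>R Sig m)) (rejection_region R r N \<beta> \<Omega> C))
    \<longlonglongrightarrow> measure std_gauss {g. quad (R *v ols X (a *\<^sub>R z + e *\<^sub>R (root_Sbar *v g))) (root_\<Gamma> *v g) \<ge> 0}"
proof -
  let ?W = "rejection_region R r N \<beta> \<Omega> C"
  have "measure (gaussian (X *v b + c m *\<^sub>R z) (\<sigma>\<^sup>2 *\<^sub>R Sig m)) ?W
      = measure std_gauss {g. test_stat R r N \<beta> \<Omega> (X *v b + c m *\<^sub>R z
          + \<sigma> *\<^sub>R ((P + sqrt (s m) *\<^sub>R (mat 1 - P)) *v (sqrt_mat (Gam m) *v g))) \<ge> C}" for m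
    unfolding gaussian_Sig[OF assms(1)] shrink_def Q_def
    by (subst measure_distr) (auto simp: rejection_region_def vimage_def)
  moreover have "P *v x \<in> colspace X" for x using P_in L_sub by auto
  ultimately show ?thesis
    using tendsto_prob_test_stat[OF sqrt_Gam_lim _ s_pos s_lim assms(1) d _ assms(2), where P=P and z=z and C=C]
      assms(3) L_sub nz by (auto simp: P_sqrt_\<Gamma> root_Sbar_def root_\<Gamma>_def)
qed

definition A where
  "A = matrix_inv (transpose Z ** Z) ** transpose Z ** Sbar ** Z ** matrix_inv (transpose Z ** Z)"

text \<open>The matrix of \<open>ols Z\<close>, which gives the coordinates with respect to \<open>Z\<close> of an element of \<open>L\<close>.\<close>

definition ols_mat where "ols_mat = matrix_inv (transpose Z ** Z) ** transpose Z"

lemma transpose_ols_mat: "transpose ols_mat = Z ** matrix_inv (transpose Z ** Z)"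
proof -
  have "symmetric_mat (transpose Z ** Z)" by (simp add: symmetric_mat_def matrix_transpose_mul)
  from symmetric_matrix_inv[OF this gram_invertible[OF Z(1)]]
  show ?thesis by (simp add: ols_mat_def matrix_transpose_mul symmetric_mat_def)
qed

lemma A_factor: "(ols_mat ** root_Sbar) ** transpose (ols_mat ** root_Sbar) = A"
proof -
  have "(ols_mat ** root_Sbar) ** transpose (ols_mat ** root_Sbar) = ols_mat ** (root_Sbar ** root_Sbar) ** transpose ols_mat"
    using sqrt_mat(1)[OF Sbar] by (simp add: root_Sbar_def matrix_transpose_mul symmetric_mat_def matrix_mul_assoc)
  also have "\<dots> = A"
    unfolding transpose_ols_mat by (simp add: root_Sbar_def sqrt_mat(3)[OF Sbar] A_def ols_mat_def matrix_mul_assoc)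
  finally show ?thesis .
qed

text \<open>The form of \<open>A\<close> at \<open>x\<close> is \<open>|root_Sbar u|\<^sup>2\<close> for the vector \<open>u = Z (Z'Z)\<^sup>-\<^sup>1 x\<close> of \<open>L\<close>, and \<open>Sbar\<close> has trivial
kernel on \<open>L\<close>.\<close>

lemma pos_def_A: "pos_def_mat A"
  unfolding pos_def_mat_def
proof (intro allI impI)
  fix x :: "real^'l" assume x: "x \<noteq> 0"
  define u where "u = transpose ols_mat *v x"
  have "x \<bullet> (A *v x) = (transpose (ols_mat ** root_Sbar) *v x) \<bullet> (transpose (ols_mat ** root_Sbar) *v x)"
    unfolding A_factor[symmetric] inner_transpose_vec by (simp add: matrix_vector_mul_assoc del: transpose_matrix_vector)
  also have "transpose (ols_mat ** root_Sbar) *v x = root_Sbar *v u"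
    using sqrt_mat(1)[OF Sbar] by (simp add: u_def matrix_transpose_mul symmetric_mat_def root_Sbar_def
        matrix_vector_mul_assoc del: transpose_matrix_vector)
  finally have eq: "x \<bullet> (A *v x) = (root_Sbar *v u) \<bullet> (root_Sbar *v u)" .
  have "root_Sbar *v u \<noteq> 0"
  proof
    assume "root_Sbar *v u = 0"
    then have "Sbar *v u = 0"
      using sqrt_mat(3)[OF Sbar] by (metis root_Sbar_def matrix_vector_mul_assoc matrix_vector_mult_0_right)
    then have "u \<in> orthogonal_comp L" by (simp add: Sbar_eq_0_iff)
    moreover have u: "u = Z *v (matrix_inv (transpose Z ** Z) *v x)"
      by (simp add: u_def transpose_ols_mat matrix_vector_mul_assoc del: transpose_matrix_vector)
    then have "u \<in> L" using Z(2) by (auto simp: colspace_eq_range)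
    ultimately have "orthogonal u u" by (simp add: orthogonal_comp_def)
    then have "Z *v (matrix_inv (transpose Z ** Z) *v x) = Z *v 0"
      using u by (simp add: orthogonal_self)
    then have "matrix_inv (transpose Z ** Z) *v x = 0" using Z(1) by (metis injD)
    then have "(transpose Z ** Z) *v (matrix_inv (transpose Z ** Z) *v x) = 0" by simp
    then show False using x unfolding matrix_vector_mul_assoc
      by (simp add: matrix_inv_mult(2)[OF gram_invertible[OF Z(1)]])
  qed
  then show "x \<bullet> (A *v x) > 0" by (simp add: eq)
qed

lemma gaussian_A: "gaussian 0 A = distr std_gauss borel (\<lambda>g. (ols_mat ** root_Sbar) *v g)"
  using gaussian_eq_distr_std_gauss[OF A_factor pos_def_A, of 0] by simp

lemma Z_ols_mat_root: "Z *v ((ols_mat ** root_Sbar) *v g) = root_Sbar *v g"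
proof -
  have "root_Sbar *v g \<in> colspace Z" using P_in[of "root_Sbar *v g"] by (simp add: Z(2) root_Sbar_def P_sqrt_Sbar)
  from mult_ols_in_colspace[OF Z(1) this] show ?thesis
    by (simp add: ols_eq_matrix ols_mat_def matrix_vector_mul_assoc matrix_mul_assoc del: transpose_matrix_vector)
qed

text \<open>Coordinates with law \<open>gaussian 0 A\<close> are those of \<open>root_Sbar g'\<close> for a standard Gaussian \<open>g'\<close>, so the integral
is the iterated one of lemma \<open>quad_decouple\<close>.\<close>

lemma integral_limit_prob_A: "(\<integral>\<gamma>. limit_prob (Z *v \<gamma>) \<partial>gaussian 0 A)
    = measure std_gauss {g. quad (R *v ols X (root_Sbar *v g)) (root_\<Gamma> *v g) \<ge> 0}"
proof -
  have "(\<integral>\<gamma>. limit_prob (Z *v \<gamma>) \<partial>gaussian 0 A) = (\<integral>g. limit_prob (Z *v ((ols_mat ** root_Sbar) *v g)) \<partial>std_gauss)"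
    unfolding gaussian_A
    by (rule integral_distr) (use measurable_compose[OF matrix_vector_mult_measurable measurable_limit_prob] in auto)
  then show ?thesis by (simp add: Z_ols_mat_root integral_limit_prob_root)
qed

lemma prob_space_gaussian_A: "prob_space (gaussian 0 A)"
  unfolding gaussian_A by (intro prob_space.prob_space_distr prob_space_std_gauss) simp

lemma INF_limit_prob_le_integral:
  "(INF \<gamma>. limit_prob (Z *v \<gamma>)) \<le> (\<integral>\<gamma>. limit_prob (Z *v \<gamma>) \<partial>gaussian 0 A)"
proof -
  interpret prob_space "gaussian 0 A" by (rule prob_space_gaussian_A)
  have meas: "(\<lambda>\<gamma>. limit_prob (Z *v \<gamma>)) \<in> borel_measurable (gaussian 0 A)"
    using measurable_compose[OF matrix_vector_mult_measurable measurable_limit_prob]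
    by (simp add: gaussian_A)
  have "integrable (gaussian 0 A) (\<lambda>\<gamma>. limit_prob (Z *v \<gamma>))"
    using limit_prob_bounds by (intro integrable_const_bound[where B=1] meas) auto
  moreover have "bdd_below (range (\<lambda>\<gamma>. limit_prob (Z *v \<gamma>)))"
    using limit_prob_bounds(1) by (intro bdd_belowI[of _ 0]) auto
  ultimately show ?thesis
    by (intro integral_ge_const) (auto intro!: always_eventually cINF_lower)
qed

text \<open>For \<open>\<gamma> \<noteq> 0\<close> the probability depends on the direction of \<open>\<gamma>\<close> only, and at \<open>\<gamma> = 0\<close> it has the largest possible
value \<open>1\<close>.\<close>

lemma INF_sphere:
  "(INF \<gamma>. limit_prob (Z *v \<gamma>)) = (INF \<gamma>\<in>{\<gamma>. norm \<gamma> = 1}. limit_prob (Z *v \<gamma>))" (is "?I = ?J")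
proof (rule antisym)
  have bdd: "bdd_below ((\<lambda>\<gamma>. limit_prob (Z *v \<gamma>)) ` U)" for U
    using limit_prob_bounds(1) by (intro bdd_belowI[of _ 0]) auto
  have ne: "{\<gamma> :: real^'l. norm \<gamma> = 1} \<noteq> {}"
    using vector_choose_size[of 1, where 'a="real^'l"] by auto
  show "?I \<le> ?J" by (rule cINF_superset_mono[OF ne bdd]) auto
  show "?J \<le> ?I"
  proof (rule cINF_greatest)
    fix \<gamma> :: "real^'l"
    show "?J \<le> limit_prob (Z *v \<gamma>)"
    proof (cases "\<gamma> = 0")
      case True
      obtain \<gamma>1 :: "real^'l" where "norm \<gamma>1 = 1" using ne by auto
      then have "?J \<le> limit_prob (Z *v \<gamma>1)" by (intro cINF_lower bdd) auto
      also have "\<dots> \<le> 1" by (rule limit_prob_bounds)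
      also have "1 = limit_prob (Z *v \<gamma>)"
        using limit_prob_eq_1[of 0] linear_0[OF linear_R_ols] True by simp
      finally show ?thesis .
    next
      case False
      then have "?J \<le> limit_prob (Z *v ((1 / norm \<gamma>) *\<^sub>R \<gamma>))" by (intro cINF_lower bdd) auto
      also have "\<dots> = limit_prob (Z *v \<gamma>)"
        using False by (simp only: matrix_vector_mult_scaleR) (simp add: limit_prob_scale)
      finally show ?thesis .
    qed
  qed simp
qed

text \<open>Moving the mean to infinity along \<open>Z \<gamma>\<close> while the covariance degenerates: relative to the size of the
mean, the randomness within \<open>L\<close> becomes negligible.\<close>

lemma exists_tendsto_limit_prob:
  assumes \<sigma>: "\<sigma> > 0" and b: "R *v b = r" and nz: "R *v ols X (Z *v \<gamma>) \<noteq> 0"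
  shows "\<exists>\<delta> :: nat \<Rightarrow> real^'l. (\<forall>m. norm (\<delta> m) \<ge> M) \<and>
    (\<lambda>m. measure (gaussian (X *v b + Z *v \<delta> m) (\<sigma>\<^sup>2 *\<^sub>R Sig m)) (rejection_region R r N \<beta> \<Omega> C))
      \<longlonglongrightarrow> limit_prob (Z *v \<gamma>)"
proof -
  have \<gamma>: "\<gamma> \<noteq> 0" using nz linear_0[OF linear_R_ols] by auto
  \<comment> \<open>The factor \<open>k\<close> makes \<open>k \<gamma>\<close> longer than \<open>M\<close>, so that every positive multiple \<open>k (m + 1) \<gamma>\<close> is.\<close>
  define k where "k = \<bar>M\<bar> / norm \<gamma> + 1"
  have k: "k > 0" by (simp add: k_def add_nonneg_pos)
  define c where "c m = k * real (Suc m)" for m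
  have c: "c m > 0" for m using k by (simp add: c_def)
  have "norm (c m *\<^sub>R \<gamma>) \<ge> M" for m
  proof -
    have "M \<le> k * norm \<gamma>" using \<gamma> by (simp add: k_def algebra_simps add_increasing2)
    also have "\<dots> = k * 1 * norm \<gamma>" by simp
    also have "\<dots> \<le> c m * norm \<gamma>" using k unfolding c_def by (intro mult_right_mono mult_left_mono) auto
    finally show ?thesis using c[of m] by simp
  qed
  moreover have "(\<lambda>m. measure (gaussian (X *v b + c m *\<^sub>R (Z *v \<gamma>)) (\<sigma>\<^sup>2 *\<^sub>R Sig m)) (rejection_region R r N \<beta> \<Omega> C))
    \<longlonglongrightarrow> measure std_gauss {g. quad (R *v ols X (1 *\<^sub>R (Z *v \<gamma>) + 0 *\<^sub>R (root_Sbar *v g))) (root_\<Gamma> *v g) \<ge> 0}"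
  proof (rule tendsto_rejection_prob[OF \<sigma> b _ c])
    show "Z *v \<gamma> \<in> L" using Z(2) by (auto simp: colspace_eq_range)
    show "(\<lambda>m. c m / c m) \<longlonglongrightarrow> 1" using less_imp_neq[OF c] by simp
    have "(\<lambda>m. (\<sigma> / k) * inverse (real (Suc m))) \<longlonglongrightarrow> (\<sigma> / k) * 0"
      by (intro tendsto_mult tendsto_const LIMSEQ_inverse_real_of_nat)
    then show "(\<lambda>m. \<sigma> / c m) \<longlonglongrightarrow> 0" by (simp add: c_def field_simps)
    show "AE g in std_gauss. quad (R *v ols X (1 *\<^sub>R (Z *v \<gamma>) + 0 *\<^sub>R (root_Sbar *v g))) (root_\<Gamma> *v g) \<noteq> 0"
      using AE_quad_nonzero[OF nz invertible_sqrt_\<Gamma>] by (simp add: root_\<Gamma>_def)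
  qed
  then have "(\<lambda>m. measure (gaussian (X *v b + Z *v (c m *\<^sub>R \<gamma>)) (\<sigma>\<^sup>2 *\<^sub>R Sig m)) (rejection_region R r N \<beta> \<Omega> C))
    \<longlonglongrightarrow> limit_prob (Z *v \<gamma>)"
    by (simp add: limit_prob_def matrix_vector_mult_scaleR)
  ultimately show ?thesis by (intro exI[of _ "\<lambda>m. c m *\<^sub>R \<gamma>"]) simp
qed

text \<open>Without a shift of the mean it is the random component in \<open>L\<close> that survives, with the role of \<open>Z \<gamma>\<close> taken
by \<open>root_Sbar g\<close>.\<close>

lemma null_reject_tendsto_integral:
  assumes \<sigma>: "\<sigma> > 0" and b: "R *v b = r"
  shows "(\<lambda>m. measure (gaussian (X *v b) (\<sigma>\<^sup>2 *\<^sub>R Sig m)) (rejection_region R r N \<beta> \<Omega> C))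
      \<longlonglongrightarrow> (\<integral>\<gamma>. limit_prob (Z *v \<gamma>) \<partial>gaussian 0 A)"
  using tendsto_rejection_prob[OF \<sigma> b subspace_0[OF subspace_L], of "\<lambda>_. \<sigma>" "\<lambda>_. 0" 0 1 C] AE_quad_nonzero_coupled \<sigma>
  by (simp add: integral_limit_prob_A)

end

section \<open>Power and size of the test\<close>

theorem theorem5p19:
  fixes X :: "real^'k^'n" and R :: "real^'k^'q" and r :: "real^'q"
    and CC :: "(real^'n^'n) set"
    and N :: "(real^'n) set"
    and \<beta> :: "real^'n \<Rightarrow> real^'k" and \<Omega> :: "real^'n \<Rightarrow> real^'q^'q"
    and C :: real
    and Sig :: "nat \<Rightarrow> real^'n^'n" and Sbar :: "real^'n^'n"
    and s :: "nat \<Rightarrow> real" and D :: "real^'n^'n"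
    and Z :: "real^'l^'n"
    and S :: "'w measure" and G :: "'w \<Rightarrow> real^'n"
  defines "L \<equiv> colspace Sbar"
    and "Lp \<equiv> orthogonal_comp (colspace Sbar)"
    and "W \<equiv> rejection_region R r N \<beta> \<Omega> C"
    and "p \<equiv> (\<lambda>\<gamma>. measure S {\<omega> \<in> space S. xi_bar X R N \<Omega> Z Sbar D (G \<omega>) \<gamma> \<ge> 0})"
    and "A \<equiv> matrix_inv (transpose Z ** Z) ** transpose Z ** Sbar ** Z
               ** matrix_inv (transpose Z ** Z)"
  assumes "CARD('k) < CARD('n)"
    and "rank X = CARD('k)"
    and "rank R = CARD('q)"
    and "covariance_model CC"
    and "regular_equivariant_pair X N \<beta> \<Omega>"
    and "\<And>v. v \<noteq> 0 \<Longrightarrow>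
           {y. y \<notin> Nstar N \<Omega> \<and> v \<bullet> (matrix_inv (\<Omega> y) *v v) = 0} \<in> null_sets lborel"
    and "0 < C"
    and "\<And>m. Sig m \<in> CC"
    and "Sig \<longlonglongrightarrow> Sbar"
    and "\<not> invertible Sbar"
    and "dim L = CARD('l)" and "dim L > 0"
    and "\<And>m. s m > 0"
    and "(\<lambda>m. (proj_mat Lp ** Sig m ** proj_mat Lp) /\<^sub>R s m) \<longlonglongrightarrow> D"
    and "inj_on ((*v) D) Lp"
    and "(\<lambda>m. (proj_mat Lp ** Sig m ** proj_mat L) /\<^sub>R sqrt (s m)) \<longlonglongrightarrow> 0"
    and "L \<subseteq> colspace X"
    and "columns_basis_of Z L"
    and "AE z in lborel_subspace L. R *v ols X z \<noteq> 0"
    and "prob_space S"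
    and "G \<in> borel_measurable S"
    and "distr S borel G = std_gaussian"
  shows "invertible A \<and>
         (INF \<gamma>. p \<gamma>) = (INF \<gamma>\<in>{\<gamma>. norm \<gamma> = 1}. p \<gamma>) \<and>
         (\<forall>\<mu>0 \<in> M0_set X R r. \<forall>\<sigma>>0. \<forall>M\<ge>0.
           (INF \<gamma>\<in>{\<gamma>. norm \<gamma> \<ge> M}. INF \<Sigma>\<in>CC. measure (gaussian (\<mu>0 + Z *v \<gamma>) (\<sigma>\<^sup>2 *\<^sub>R \<Sigma>)) W)
             \<le> (INF \<gamma>. p \<gamma>) \<and>
           (INF \<gamma>. p \<gamma>) \<le> (\<integral>\<gamma>. p \<gamma> \<partial>(gaussian 0 A)) \<and>
           (\<integral>\<gamma>. p \<gamma> \<partial>(gaussian 0 A))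
             \<le> (SUP \<Sigma>\<in>CC. measure (gaussian \<mu>0 (\<sigma>\<^sup>2 *\<^sub>R \<Sigma>)) W))"
proof -
  have L_colspace: "L = colspace Sbar" and Lp: "Lp = orthogonal_comp L"
    by (simp_all add: L_def Lp_def)
  have cov: "CC \<noteq> {}" "\<And>\<Sigma>. \<Sigma> \<in> CC \<Longrightarrow> symmetric_mat \<Sigma> \<and> pos_def_mat \<Sigma>"
    using \<open>covariance_model CC\<close> by (auto simp: covariance_model_def)
  have sub: "subspace L" by (simp add: L_colspace colspace_def)
  note Z = columns_basis_of_inj[OF \<open>columns_basis_of Z L\<close>]
  interpret T: singular_test X R r N \<beta> \<Omega> Sig Sbar s D L Z
  proof
    show "inj ((*v) X)" using \<open>rank X = CARD('k)\<close> by (simp add: full_rank_injective)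
    show "symmetric_mat (Sig m)" "pos_def_mat (Sig m)" for m
      using cov(2)[OF \<open>Sig m \<in> CC\<close>] by auto
    show "\<exists>z\<in>L. R *v ols X z \<noteq> 0"
      by (rule AE_lborel_subspace_imp_ex[OF sub]) fact
  qed (use assms Z in \<open>auto simp: L_colspace Lp\<close>)
  have A: "A = T.A" by (simp add: A_def T.A_def)
  have p: "p \<gamma> = T.limit_prob (Z *v \<gamma>)" for \<gamma>
  proof -
    have "T.limit_prob (Z *v \<gamma>)
        = measure (distr S borel G) {g. T.quad (R *v ols X (Z *v \<gamma>)) (T.root_\<Gamma> *v g) \<ge> 0}"
      using \<open>distr S borel G = std_gaussian\<close> by (simp add: T.limit_prob_def std_gaussian_eq_std_gauss)
    also have "\<dots> = p \<gamma>"
      using T.borel_quad_root[of "{0..}"] \<open>G \<in> borel_measurable S\<close>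
      by (subst measure_distr)
         (auto simp: p_def T.xi_bar_eq_quad T.root_\<Gamma>_def T.sqrt_\<Gamma> vimage_def Int_def conj_commute)
    finally show ?thesis by simp
  qed
  have prob: "0 \<le> measure (gaussian \<mu> \<Phi>) W" "measure (gaussian \<mu> \<Phi>) W \<le> 1" for \<mu> and \<Phi> :: "real^'n^'n"
    using prob_space.prob_le_1[OF prob_space_gaussian] by auto
  have first: "(INF \<gamma>\<in>{\<gamma>. norm \<gamma> \<ge> M}. INF \<Sigma>\<in>CC. measure (gaussian (\<mu>0 + Z *v \<gamma>) (\<sigma>\<^sup>2 *\<^sub>R \<Sigma>)) W) \<le> p \<gamma>"
    if \<mu>0: "\<mu>0 = X *v b" "R *v b = r" and \<sigma>: "\<sigma> > 0" for \<mu>0 b \<sigma> M \<gamma>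
  proof -
    let ?I = "\<lambda>\<gamma>. INF \<Sigma>\<in>CC. measure (gaussian (\<mu>0 + Z *v \<gamma>) (\<sigma>\<^sup>2 *\<^sub>R \<Sigma>)) W"
    have I_le: "?I \<gamma> \<le> measure (gaussian (\<mu>0 + Z *v \<gamma>) (\<sigma>\<^sup>2 *\<^sub>R Sig m)) W" for \<gamma> m
      using prob(1) \<open>Sig m \<in> CC\<close> by (intro cINF_lower bdd_belowI[of _ 0]) auto
    have I_pos: "?I \<gamma> \<ge> 0" for \<gamma> using cov(1) prob(1) by (intro cINF_greatest)
    have II_le: "(INF \<gamma>\<in>{\<gamma>. norm \<gamma> \<ge> M}. ?I \<gamma>) \<le> measure (gaussian (\<mu>0 + Z *v \<gamma>) (\<sigma>\<^sup>2 *\<^sub>R Sig m)) W"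
      if "norm \<gamma> \<ge> M" for \<gamma> m
    proof -
      have "(INF \<gamma>\<in>{\<gamma>. norm \<gamma> \<ge> M}. ?I \<gamma>) \<le> ?I \<gamma>"
        using that I_pos by (intro cINF_lower bdd_belowI[of _ 0]) auto
      then show ?thesis using I_le order_trans by blast
    qed
    show ?thesis
    proof (cases "R *v ols X (Z *v \<gamma>) = 0")
      \<comment> \<open>Here the limit variable vanishes identically, so the right-hand side is \<open>1\<close>.\<close>
      case True
      obtain \<gamma>1 :: "real^'l" where "norm \<gamma>1 = \<bar>M\<bar>" using vector_choose_size[of "\<bar>M\<bar>"] by auto
      then have "(INF \<gamma>\<in>{\<gamma>. norm \<gamma> \<ge> M}. ?I \<gamma>) \<le> measure (gaussian (\<mu>0 + Z *v \<gamma>1) (\<sigma>\<^sup>2 *\<^sub>R Sig 0)) W"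
        by (intro II_le) simp
      also have "\<dots> \<le> 1" by (rule prob)
      finally show ?thesis using T.limit_prob_eq_1[OF True] p by simp
    next
      case False
      obtain \<delta> :: "nat \<Rightarrow> real^'l" where \<delta>: "\<And>m. norm (\<delta> m) \<ge> M"
        and lim: "(\<lambda>m. measure (gaussian (X *v b + Z *v \<delta> m) (\<sigma>\<^sup>2 *\<^sub>R Sig m)) W) \<longlonglongrightarrow> T.limit_prob (Z *v \<gamma>)"
        using T.exists_tendsto_limit_prob[OF \<sigma> \<mu>0(2) False, of M C] unfolding W_def by blast
      have "(INF \<gamma>\<in>{\<gamma>. norm \<gamma> \<ge> M}. ?I \<gamma>) \<le> T.limit_prob (Z *v \<gamma>)"
        using lim by (rule LIMSEQ_le_const) (use II_le[OF \<delta>] \<mu>0(1) in blast)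
      then show ?thesis by (simp add: p)
    qed
  qed
  have last: "(\<integral>\<gamma>. p \<gamma> \<partial>(gaussian 0 A)) \<le> (SUP \<Sigma>\<in>CC. measure (gaussian \<mu>0 (\<sigma>\<^sup>2 *\<^sub>R \<Sigma>)) W)"
    if \<mu>0: "\<mu>0 = X *v b" "R *v b = r" and \<sigma>: "\<sigma> > 0" for \<mu>0 b \<sigma>
  proof (rule LIMSEQ_le_const2)
    show "(\<lambda>m. measure (gaussian \<mu>0 (\<sigma>\<^sup>2 *\<^sub>R Sig m)) W) \<longlonglongrightarrow> (\<integral>\<gamma>. p \<gamma> \<partial>(gaussian 0 A))"
      using T.null_reject_tendsto_integral[OF \<sigma> \<mu>0(2), of C] by (simp add: W_def A p \<mu>0(1))
    have "measure (gaussian \<mu>0 (\<sigma>\<^sup>2 *\<^sub>R Sig m)) W \<le> (SUP \<Sigma>\<in>CC. measure (gaussian \<mu>0 (\<sigma>\<^sup>2 *\<^sub>R \<Sigma>)) W)" for m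
      using prob(2) \<open>Sig m \<in> CC\<close> by (intro cSUP_upper bdd_aboveI[of _ 1]) auto
    then show "\<exists>N. \<forall>m\<ge>N. measure (gaussian \<mu>0 (\<sigma>\<^sup>2 *\<^sub>R Sig m)) W
        \<le> (SUP \<Sigma>\<in>CC. measure (gaussian \<mu>0 (\<sigma>\<^sup>2 *\<^sub>R \<Sigma>)) W)" by blast
  qed
  have "invertible A" unfolding A by (rule pos_def_mat_invertible[OF T.pos_def_A])
  moreover have "(INF \<gamma>. p \<gamma>) = (INF \<gamma>\<in>{\<gamma>. norm \<gamma> = 1}. p \<gamma>)"
    unfolding p by (rule T.INF_sphere)
  moreover have "(INF \<gamma>. p \<gamma>) \<le> (\<integral>\<gamma>. p \<gamma> \<partial>(gaussian 0 A))"
    unfolding p A by (rule T.INF_limit_prob_le_integral)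
  moreover have "(INF \<gamma>\<in>{\<gamma>. norm \<gamma> \<ge> M}. INF \<Sigma>\<in>CC. measure (gaussian (\<mu>0 + Z *v \<gamma>) (\<sigma>\<^sup>2 *\<^sub>R \<Sigma>)) W)
      \<le> (INF \<gamma>. p \<gamma>)" if "\<mu>0 \<in> M0_set X R r" "\<sigma> > 0" for \<mu>0 \<sigma> M
    using that first by (intro cINF_greatest) (auto simp: M0_set_def)
  ultimately show ?thesis using last by (auto simp: M0_set_def)
qed

end
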